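(* Let $p$ be a prime number. For any even integer $\lambda \geq 0$ and any integer $\mu \geq 0$, there exists a (possibly ramified) $\mathbb{Z}_p$-covering $X_\infty/X$ of connected graphs satisfying $\lambda(X_\infty/X) = \lambda$ and $\mu(X_\infty/X) = \mu$. Indeed, such a covering exists with $X$ a graph with exactly two vertices, one unramified and the other totally ramified in $X_\infty/X$.
   Context: Graphs (Serre's formalism): a graph $X$ consists of finite sets $V_X$ (vertices) and $\mathbb{E}_X$ (edges, oriented), an involution $e \mapsto \overline{e}$ of $\mathbb{E}_X$ without fixed elements, and maps $s,t:\mathbb{E}_X \to V_X$ with $s(\overline{e}) = t(e)$, $t(\overline{e}) = s(e)$. So multi-edges and loops are allowed, and each pair $\{e,\overline{e}\}$ is one undirected edge. $\kappa_X$ denotes the number of spanning trees of $X$ (as an undirected multigraph, undirected edges being the pairs $\{e,\overline e\}$). (Ramified) $\mathbb{Z}_p$-coverings: let $\Gamma$ be a profinite group, written multiplicatively, isomorphic to $\mathbb{Z}_p$, and $\Gamma_n = \Gamma/\Gamma^{p^n}$ for $n \ge 0$. A voltage assignment is a map $\alpha: \mathbb{E}_X \to \Gamma$ with $\alpha(\overline{e}) = \alpha(e)^{-1}$ for all $e$. Let also $\mathcal{I} = (I_v)_{v \in V_X}$ be a family of closed subgroups of $\Gamma$, and let $I_{v,n}$ be the image of $I_v$ in $\Gamma_n$. The derived graph $X_n$ has $V_{X_n} = \coprod_{v \in V_X} (\Gamma_n/I_{v,n} \times \{v\})$, $\mathbb{E}_{X_n} = \Gamma_n \times \mathbb{E}_X$,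 with $\overline{(\gamma,e)} = (\gamma\cdot\alpha(e),\overline{e})$, $s((\gamma,e)) = (\gamma I_{s(e),n},s(e))$, $t((\gamma,e)) = (\gamma\cdot\alpha(e) I_{t(e),n},t(e))$. The tower $X = X_0 \leftarrow X_1 \leftarrow X_2 \leftarrow\cdots$ (with maps induced by the natural projections), provided all $X_n$ are connected, is a $\mathbb{Z}_p$-covering of connected graphs, written $X_\infty/X$; every $\mathbb{Z}_p$-covering of connected graphs is, up to isomorphism, of this form, and this may be taken as the definition. A vertex $v$ is unramified if $I_v$ is trivial and totally ramified if $I_v = \Gamma$. Iwasawa invariants: for such $X_\infty/X$ it is known that there are unique non-negative integers $\lambda(X_\infty/X)$, $\mu(X_\infty/X)$ and an integer $\nu$ such that $\operatorname{ord}_p(\kappa_{X_n}) = \lambda(X_\infty/X)\, n + \mu(X_\infty/X)\, p^n + \nu$ for all sufficiently large $n$, where $\operatorname{ord}_p$ is the $p$-adic valuation with $\operatorname{ord}_p(p)=1$. *)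

theory Defs
  imports
    "HOL-Algebra.Coset"
    "HOL-Analysis.Function_Topology"
    "HOL-Computational_Algebra.Primes"
begin

section \<open>Serre graphs and spanning trees\<close>

record ('v, 'e) sgraph =
  verts :: "'v set"
  edges :: "'e set"
  einv :: "'e \<Rightarrow> 'e"
  src :: "'e \<Rightarrow> 'v"
  tgt :: "'e \<Rightarrow> 'v"

locale serre_graph =
  fixes X :: "('v, 'e) sgraph"
  assumes finite_verts: "finite (verts X)"
    and finite_edges: "finite (edges X)"
    and einv_in: "e \<in> edges X \<Longrightarrow> einv X e \<in> edges X"
    and einv_einv: "e \<in> edges X \<Longrightarrow> einv X (einv X e) = e"
    and einv_neq: "e \<in> edges X \<Longrightarrow> einv X e \<noteq> e"
    and src_in: "e \<in> edges X \<Longrightarrow> src X e \<in> verts X"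
    and tgt_in: "e \<in> edges X \<Longrightarrow> tgt X e \<in> verts X"
    and src_einv: "e \<in> edges X \<Longrightarrow> src X (einv X e) = tgt X e"
    and tgt_einv: "e \<in> edges X \<Longrightarrow> tgt X (einv X e) = src X e"

definition connected_graph :: "('v, 'e) sgraph \<Rightarrow> bool" where
  "connected_graph X \<longleftrightarrow> verts X \<noteq> {} \<and>
     (\<forall>u\<in>verts X. \<forall>w\<in>verts X. (u, w) \<in> {(src X e, tgt X e) | e. e \<in> edges X}\<^sup>*)"

text \<open>
  A circuit is a closed path without repeated vertices that uses no undirected edge in both
  directions. A loop is a circuit of length one, and two distinct parallel undirected edges
  give a circuit of length two.
\<close>
definition circuit :: "('v, 'e) sgraph \<Rightarrow> 'e list \<Rightarrow> bool" where
  "circuit X c \<longleftrightarrow> c \<noteq> [] \<and> set c \<subseteq> edges X \<and>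
     (\<forall>i. Suc i < length c \<longrightarrow> tgt X (c ! i) = src X (c ! Suc i)) \<and>
     tgt X (last c) = src X (hd c) \<and>
     distinct (map (src X) c) \<and>
     (\<forall>e\<in>set c. einv X e \<notin> set c)"

definition tree_graph :: "('v, 'e) sgraph \<Rightarrow> bool" where
  "tree_graph X \<longleftrightarrow> connected_graph X \<and> (\<nexists>c. circuit X c)"

definition undirected_edges :: "('v, 'e) sgraph \<Rightarrow> 'e set set" where
  "undirected_edges X = (\<lambda>e. {e, einv X e}) ` edges X"

text \<open>
  A spanning tree contains all vertices, so it is given by its set of undirected edges.
\<close>
definition spanning_trees :: "('v, 'e) sgraph \<Rightarrow> 'e set set set" where
  "spanning_trees X = {S. S \<subseteq> undirected_edges X \<and> tree_graph (X\<lparr>edges := \<Union>S\<rparr>)}"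

definition num_spanning_trees :: "('v, 'e) sgraph \<Rightarrow> nat" where
  "num_spanning_trees X = card (spanning_trees X)"


section \<open>The group of p-adic integers\<close>

text \<open>
  The inverse limit of the rings of integers modulo \<open>p ^ n\<close>, realised as compatible sequences of
  least nonnegative residues with the topology inherited from the product of the discrete
  spaces. The additive group is written multiplicatively.
\<close>
definition Zp :: "nat \<Rightarrow> (nat \<Rightarrow> int) monoid" where
  "Zp p = \<lparr> carrier = {x. \<forall>n. x n \<in> {0..<int p ^ n} \<and> x (Suc n) mod int p ^ n = x n},
            monoid.mult = (\<lambda>x y n. (x n + y n) mod int p ^ n),
            monoid.one = (\<lambda>_. 0) \<rparr>"

definition Zp_topology :: "nat \<Rightarrow> (nat \<Rightarrow> int) topology" where
  "Zp_topology p =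
     subtopology (product_topology (\<lambda>_. discrete_topology UNIV) UNIV) (carrier (Zp p))"

definition isomorphic_to_Zp :: "nat \<Rightarrow> 'g monoid \<Rightarrow> 'g topology \<Rightarrow> bool" where
  "isomorphic_to_Zp p \<Gamma> T \<longleftrightarrow> group \<Gamma> \<and> topspace T = carrier \<Gamma> \<and>
     (\<exists>f. f \<in> iso \<Gamma> (Zp p) \<and> homeomorphic_map T (Zp_topology p) f)"


section \<open>Derived graphs and coverings\<close>

definition power_subgroup :: "'g monoid \<Rightarrow> nat \<Rightarrow> 'g set" where
  "power_subgroup \<Gamma> k = (\<lambda>x. x [^]\<^bsub>\<Gamma>\<^esub> k) ` carrier \<Gamma>"

definition layer :: "nat \<Rightarrow> 'g monoid \<Rightarrow> nat \<Rightarrow> 'g set monoid" where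
  "layer p \<Gamma> n = \<Gamma> Mod power_subgroup \<Gamma> (p ^ n)"

definition layer_proj :: "nat \<Rightarrow> 'g monoid \<Rightarrow> nat \<Rightarrow> 'g \<Rightarrow> 'g set" where
  "layer_proj p \<Gamma> n x = power_subgroup \<Gamma> (p ^ n) #>\<^bsub>\<Gamma>\<^esub> x"

definition inertia :: "nat \<Rightarrow> 'g monoid \<Rightarrow> ('v \<Rightarrow> 'g set) \<Rightarrow> nat \<Rightarrow> 'v \<Rightarrow> 'g set set" where
  "inertia p \<Gamma> I n v = layer_proj p \<Gamma> n ` I v"

text \<open>
  The groups are abelian, so the cosets \<open>\<gamma>I\<close> are written as right cosets, which are the
  elements of the library's quotient group.
\<close>
definition derived_graph ::
  "nat \<Rightarrow> 'g monoid \<Rightarrow> ('v, 'e) sgraph \<Rightarrow> ('e \<Rightarrow> 'g) \<Rightarrow> ('v \<Rightarrow> 'g set) \<Rightarrow> nat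
     \<Rightarrow> ('g set set \<times> 'v, 'g set \<times> 'e) sgraph" where
  "derived_graph p \<Gamma> X \<alpha> I n =
     (let G = layer p \<Gamma> n; J = inertia p \<Gamma> I n; a = (\<lambda>e. layer_proj p \<Gamma> n (\<alpha> e)) in
      \<lparr> verts = (\<Union>v\<in>verts X. carrier (G Mod J v) \<times> {v}),
        edges = carrier G \<times> edges X,
        einv = (\<lambda>(\<gamma>, e). (\<gamma> \<otimes>\<^bsub>G\<^esub> a e, einv X e)),
        src = (\<lambda>(\<gamma>, e). (J (src X e) #>\<^bsub>G\<^esub> \<gamma>, src X e)),
        tgt = (\<lambda>(\<gamma>, e). (J (tgt X e) #>\<^bsub>G\<^esub> (\<gamma> \<otimes>\<^bsub>G\<^esub> a e), tgt X e)) \<rparr>)"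

text \<open>
  A (possibly ramified) \<open>\<int>\<^sub>p\<close>-covering of connected graphs, given by its voltage
  assignment \<open>\<alpha>\<close> and its family \<open>I\<close> of closed subgroups.
\<close>
locale Zp_covering = serre_graph X
  for p :: nat and \<Gamma> :: "'g monoid" and T :: "'g topology"
    and X :: "('v, 'e) sgraph" and \<alpha> :: "'e \<Rightarrow> 'g" and I :: "'v \<Rightarrow> 'g set" +
  assumes iso_Zp: "isomorphic_to_Zp p \<Gamma> T"
    and voltage_in: "e \<in> edges X \<Longrightarrow> \<alpha> e \<in> carrier \<Gamma>"
    and voltage_einv: "e \<in> edges X \<Longrightarrow> \<alpha> (einv X e) = inv\<^bsub>\<Gamma>\<^esub> (\<alpha> e)"
    and subgroup_I: "v \<in> verts X \<Longrightarrow> subgroup (I v) \<Gamma>"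
    and closed_I: "v \<in> verts X \<Longrightarrow> closedin T (I v)"
    and connected_layers: "connected_graph (derived_graph p \<Gamma> X \<alpha> I n)"

definition unramified :: "'g monoid \<Rightarrow> ('v \<Rightarrow> 'g set) \<Rightarrow> 'v \<Rightarrow> bool" where
  "unramified \<Gamma> I v \<longleftrightarrow> I v = {\<one>\<^bsub>\<Gamma>\<^esub>}"

definition totally_ramified :: "'g monoid \<Rightarrow> ('v \<Rightarrow> 'g set) \<Rightarrow> 'v \<Rightarrow> bool" where
  "totally_ramified \<Gamma> I v \<longleftrightarrow> I v = carrier \<Gamma>"


section \<open>Iwasawa invariants\<close>

definition iwasawa_invariants ::
  "nat \<Rightarrow> 'g monoid \<Rightarrow> ('v, 'e) sgraph \<Rightarrow> ('e \<Rightarrow> 'g) \<Rightarrow> ('v \<Rightarrow> 'g set) \<Rightarrow> nat \<Rightarrow> nat \<Rightarrow> bool" where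
  "iwasawa_invariants p \<Gamma> X \<alpha> I l m \<longleftrightarrow>
     (\<exists>\<nu>::int. \<forall>\<^sub>F n in sequentially.
        int (multiplicity p (num_spanning_trees (derived_graph p \<Gamma> X \<alpha> I n)))
          = int l * int n + int m * int p ^ n + \<nu>)"

text \<open>
  The relation determines both invariants, so it expresses that they equal \<open>l\<close> and \<open>m\<close>.
\<close>
lemma iwasawa_invariants_unique:
  assumes "prime p" "iwasawa_invariants p \<Gamma> X \<alpha> I l m" "iwasawa_invariants p \<Gamma> X \<alpha> I l' m'"
  shows "l = l' \<and> m = m'"
proof -
  define K where "K n = int (multiplicity p (num_spanning_trees (derived_graph p \<Gamma> X \<alpha> I n)))" for n
  obtain \<nu> \<nu>' where
    "\<forall>\<^sub>F n in sequentially. K n = int l * int n + int m * int p ^ n + \<nu>"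
    "\<forall>\<^sub>F n in sequentially. K n = int l' * int n + int m' * int p ^ n + \<nu>'"
    using assms(2,3) unfolding iwasawa_invariants_def K_def by blast
  then have ev: "\<forall>\<^sub>F n in sequentially.
      int l * int n + int m * int p ^ n + \<nu> = int l' * int n + int m' * int p ^ n + \<nu>'"
    by eventually_elim linarith
  define a b where "a = int l - int l'" and "b = int m - int m'"
  obtain N where N: "\<And>n. n \<ge> N \<Longrightarrow> a * int n + b * int p ^ n = \<nu>' - \<nu>"
    using ev unfolding eventually_sequentially a_def b_def by (auto simp: algebra_simps)
  have step: "a + b * (int p ^ n * (int p - 1)) = 0" if "n \<ge> N" for n
    using N[of n] N[of "Suc n"] that by (simp add: algebra_simps)
  have ab: "a + b * (int p ^ N * (int p - 1)) = 0"
    using step[of N] by simp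
  have "b * (int p ^ N * (int p - 1) * (int p - 1)) = 0"
    using step[of N] step[of "Suc N"] by (simp add: algebra_simps)
  then have "b = 0"
    using prime_gt_1_nat[OF assms(1)] by auto
  with ab show ?thesis
    by (simp add: a_def b_def)
qed

end

theory Submission
  imports Defs "Jordan_Normal_Form.Determinant" "HOL-Number_Theory.Cong" "HOL-Analysis.T1_Spaces"
begin

text \<open>
  Let the base graph have an unramified vertex \<open>v\<close>, a totally ramified vertex \<open>w\<close>, \<open>K > 0\<close> edges
  between them, and loops at \<open>v\<close> with integer voltages \<open>j\<close>. In the \<open>n\<close>-th layer a single vertex,
  the hub, lies over \<open>w\<close>, and it is adjacent to all others, so the layer is connected. Deleting the
  hub from the Laplacian leaves the matrix of multiplication by
  \<open>g = K + (\<Sum>j. 2 - \<gamma>^j - \<gamma>^(-j))\<close> on the group ring of the integers modulo \<open>p^n\<close>. By the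
  matrix-tree theorem (\<open>matrix_tree\<close>) and the Fourier transform (\<open>det_circulant\<close>), the number of
  spanning trees is the product of \<open>g(\<zeta>)\<close> over all \<open>\<zeta>\<close> with \<open>\<zeta>^(p^n) = 1\<close>
  (\<open>num_spanning_trees_Y\<close>).

  Write \<open>l = 2r\<close>. The Laurent polynomial \<open>x^(-r) * (x - 1)^(2r)\<close> is symmetric and, for \<open>r > 0\<close>,
  vanishes at 1, so it is an integer combination of the polynomials \<open>2 - x^j - x^(-j)\<close>. Reducing the
  coefficients modulo \<open>p\<close> makes them nonnegative, and \<open>K = p\<close> disappears modulo \<open>p\<close>. So some
  choice of loops achieves \<open>g = x^(-r) * (x - 1)^(2r)\<close> modulo \<open>p\<close> (\<open>loop_combination_exists\<close>).

  Going from layer \<open>n\<close> to layer \<open>n + 1\<close> multiplies the number of trees by the product of \<open>g(\<zeta>)\<close>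
  over the roots of unity of exact order \<open>p^(n+1)\<close>. There \<open>p\<close> is a unit times \<open>(\<zeta> - 1)^\<phi>\<close>, where
  \<open>\<phi>\<close> is the number of these roots; so as soon as \<open>\<phi> > 2r\<close>, \<open>g(\<zeta>)\<close> is a unit times
  \<open>(\<zeta> - 1)^(2r)\<close>, and the product has valuation \<open>2r\<close>. To stay within integer polynomials, units are
  replaced by polynomials whose value at 1 is prime to \<open>p\<close>: their norms are prime to \<open>p\<close> because
  \<open>x^(p^n) - 1\<close> is a power of \<open>x - 1\<close> modulo \<open>p\<close> (\<open>cyc_norm_not_dvd\<close>,
  \<open>multiplicity_cyc_norm_Suc\<close>).

  Finally, replacing every edge by \<open>p^m\<close> parallel copies multiplies \<open>g\<close> by \<open>p^m\<close> and adds
  \<open>m * p^n\<close> to the valuation, which yields the prescribed second invariant.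
\<close>


section \<open>Spanning trees and determinants\<close>

text \<open>
  Choices of one outgoing edge at every vertex other than the root \<open>w\<close>. A strictly decreasing
  rank expresses that following the choices never runs into a cycle, so that it ends at \<open>w\<close>.
\<close>
definition arborescences :: "('v, 'e) sgraph \<Rightarrow> 'v \<Rightarrow> ('v \<Rightarrow> 'e) set" where
  "arborescences X w =
     {\<sigma> \<in> Pi\<^sub>E (verts X - {w}) (\<lambda>v. {e \<in> edges X. src X e = v}).
        \<exists>\<rho> :: 'v \<Rightarrow> nat. \<forall>v\<in>verts X - {w}. \<rho> (tgt X (\<sigma> v)) < \<rho> v}"

definition support :: "('v, 'e) sgraph \<Rightarrow> 'v \<Rightarrow> ('v \<Rightarrow> 'e) \<Rightarrow> 'e set set" where
  "support X w \<sigma> = (\<lambda>v. {\<sigma> v, einv X (\<sigma> v)}) ` (verts X - {w})"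

lemma connected_graph_restrict:
  "connected_graph (X\<lparr>edges := E\<rparr>) \<longleftrightarrow> verts X \<noteq> {} \<and>
     (\<forall>u\<in>verts X. \<forall>w\<in>verts X. (u, w) \<in> {(src X e, tgt X e) | e. e \<in> E}\<^sup>*)"
  by (simp add: connected_graph_def)

fun walk :: "('v, 'e) sgraph \<Rightarrow> 'v \<Rightarrow> 'e list \<Rightarrow> 'v \<Rightarrow> bool" where
  "walk X u [] w \<longleftrightarrow> u = w"
| "walk X u (e # c) w \<longleftrightarrow> src X e = u \<and> walk X (tgt X e) c w"

lemma walk_append: "walk X u (c @ d) w \<longleftrightarrow> (\<exists>x. walk X u c x \<and> walk X x d w)"
  by (induction c arbitrary: u) auto

lemma walk_steps:
  assumes "walk X u c w"
  shows "Suc i < length c \<Longrightarrow> tgt X (c ! i) = src X (c ! Suc i)"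
    and "c \<noteq> [] \<Longrightarrow> src X (hd c) = u \<and> tgt X (last c) = w"
proof -
  show "Suc i < length c \<Longrightarrow> tgt X (c ! i) = src X (c ! Suc i)"
    using assms
  proof (induction c arbitrary: u i)
    case (Cons e c)
    then show ?case by (cases c; cases i) auto
  qed simp
  show "c \<noteq> [] \<Longrightarrow> src X (hd c) = u \<and> tgt X (last c) = w"
    using assms by (induction c arbitrary: u) auto
qed

text \<open>
  Cutting a walk at a repeated vertex shortens it, so joined vertices are joined by a walk
  without repeated vertices.
\<close>
lemma simple_walk_exists:
  assumes "(u, w) \<in> {(src X e, tgt X e) | e. e \<in> E}\<^sup>*"
  shows "\<exists>c. set c \<subseteq> E \<and> walk X u c w \<and> distinct (map (src X) c @ [w])"
  using assms
proof (induction rule: converse_rtrancl_induct)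
  case base
  show ?case by (rule exI[of _ "[]"]) simp
next
  case (step u x)
  then obtain e c where e: "e \<in> E" "src X e = u" "tgt X e = x"
    and c: "set c \<subseteq> E" "walk X x c w" "distinct (map (src X) c @ [w])"
    by auto
  consider "u = w" | "u \<noteq> w" "u \<in> src X ` set c" | "u \<noteq> w" "u \<notin> src X ` set c" by blast
  then show ?case
  proof cases
    case 1
    then show ?thesis by (intro exI[of _ "[]"]) simp
  next
    case 2
    then obtain f where f: "f \<in> set c" "src X f = u" by auto
    then obtain c1 c2 where c12: "c = c1 @ f # c2" by (meson split_list)
    show ?thesis
      using c f unfolding c12 by (intro exI[of _ "f # c2"]) (auto simp: walk_append)
  next
    case 3
    then show ?thesis using e c by (intro exI[of _ "e # c"]) auto
  qed
qed

context serre_graph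
begin

lemma support_edges:
  assumes "\<sigma> \<in> arborescences X w"
  shows "\<Union> (support X w \<sigma>) \<subseteq> edges X" and "support X w \<sigma> \<subseteq> undirected_edges X"
    and "e \<in> \<Union> (support X w \<sigma>) \<Longrightarrow> einv X e \<in> \<Union> (support X w \<sigma>)"
proof -
  have \<sigma>: "\<sigma> v \<in> edges X" if "v \<in> verts X - {w}" for v
    using assms that by (auto simp: arborescences_def Pi_iff)
  then show "\<Union> (support X w \<sigma>) \<subseteq> edges X" "support X w \<sigma> \<subseteq> undirected_edges X"
    by (force simp: support_def undirected_edges_def intro: einv_in)+
  show "einv X e \<in> \<Union> (support X w \<sigma>)" if "e \<in> \<Union> (support X w \<sigma>)"
  proof -
    obtain v where v: "v \<in> verts X - {w}" "e = \<sigma> v \<or> e = einv X (\<sigma> v)"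
      using \<open>e \<in> \<Union> (support X w \<sigma>)\<close> unfolding support_def by blast
    then show ?thesis using einv_einv[OF \<sigma>[OF v(1)]] by (auto simp: support_def)
  qed
qed

text \<open>
  Following an arborescence from any vertex decreases the rank until the root is reached; by
  symmetry of the support every two vertices are then joined through the root.
\<close>
lemma support_connected:
  assumes w: "w \<in> verts X" and "\<sigma> \<in> arborescences X w"
  shows "connected_graph (X\<lparr>edges := \<Union> (support X w \<sigma>)\<rparr>)"
proof -
  define E where "E = \<Union> (support X w \<sigma>)"
  define R where "R = {(src X e, tgt X e) | e. e \<in> E}"
  obtain \<rho> :: "'v \<Rightarrow> nat" where \<sigma>: "\<And>v. v \<in> verts X - {w} \<Longrightarrow> \<sigma> v \<in> edges X \<and> src X (\<sigma> v) = v"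
    and \<rho>: "\<And>v. v \<in> verts X - {w} \<Longrightarrow> \<rho> (tgt X (\<sigma> v)) < \<rho> v"
    using assms(2) by (auto simp: arborescences_def Pi_iff)
  have to_root: "(v, w) \<in> R\<^sup>*" if "v \<in> verts X" for v
    using that
  proof (induction "\<rho> v" arbitrary: v rule: less_induct)
    case less
    show ?case
    proof (cases "v = w")
      case False
      then have v: "v \<in> verts X - {w}" using less by auto
      have "(v, tgt X (\<sigma> v)) \<in> R" using v \<sigma>[OF v] unfolding R_def E_def support_def by force
      moreover have "(tgt X (\<sigma> v), w) \<in> R\<^sup>*"
        using less.hyps[OF \<rho>[OF v]] \<sigma>[OF v] tgt_in by blast
      ultimately show ?thesis by (rule converse_rtrancl_into_rtrancl)
    qed simp
  qed
  have "sym R"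
  proof (rule symI)
    fix a b assume "(a, b) \<in> R"
    then obtain e where e: "e \<in> E" "a = src X e" "b = tgt X e" by (auto simp: R_def)
    have "e \<in> edges X" using e support_edges(1)[OF assms(2)] by (auto simp: E_def)
    then have "src X (einv X e) = b" "tgt X (einv X e) = a" using e src_einv tgt_einv by auto
    moreover have "einv X e \<in> E" using e support_edges(3)[OF assms(2)] by (auto simp: E_def)
    ultimately show "(b, a) \<in> R" unfolding R_def by blast
  qed
  then have "(w, v) \<in> R\<^sup>*" if "v \<in> verts X" for v
    using that by (blast intro: symD[OF sym_rtrancl] to_root)
  with to_root w show ?thesis
    unfolding connected_graph_restrict R_def[symmetric] E_def[symmetric]
    by (blast intro: rtrancl_trans)
qed

text \<open>
  A vertex of maximal rank on a circuit could only be left and entered through the two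
  orientations of the one edge that the arborescence chooses there.
\<close>
lemma support_no_circuit:
  assumes "\<sigma> \<in> arborescences X w"
  shows "\<not> circuit (X\<lparr>edges := \<Union> (support X w \<sigma>)\<rparr>) c"
proof
  assume "circuit (X\<lparr>edges := \<Union> (support X w \<sigma>)\<rparr>) c"
  then have c: "c \<noteq> []" "set c \<subseteq> \<Union> (support X w \<sigma>)"
      "\<And>i. Suc i < length c \<Longrightarrow> tgt X (c ! i) = src X (c ! Suc i)"
      "tgt X (last c) = src X (hd c)" "\<And>e. e \<in> set c \<Longrightarrow> einv X e \<notin> set c"
    by (auto simp: circuit_def)
  obtain \<rho> :: "'v \<Rightarrow> nat" where \<sigma>: "\<And>v. v \<in> verts X - {w} \<Longrightarrow> \<sigma> v \<in> edges X \<and> src X (\<sigma> v) = v"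
    and \<rho>: "\<And>v. v \<in> verts X - {w} \<Longrightarrow> \<rho> (tgt X (\<sigma> v)) < \<rho> v"
    using assms by (auto simp: arborescences_def Pi_iff)
  have edge: "(\<rho> (tgt X e) < \<rho> (src X e) \<and> e = \<sigma> (src X e)) \<or>
      (\<rho> (src X e) < \<rho> (tgt X e) \<and> e = einv X (\<sigma> (tgt X e)))" if e: "e \<in> set c" for e
  proof -
    obtain v where v: "v \<in> verts X - {w}" "e = \<sigma> v \<or> e = einv X (\<sigma> v)"
      using c(2) e by (auto simp: support_def)
    then show ?thesis using \<sigma>[OF v(1)] \<rho>[OF v(1)] by (auto simp: src_einv tgt_einv)
  qed
  obtain e where e: "e \<in> set c" "\<And>f. f \<in> set c \<Longrightarrow> \<rho> (src X f) \<le> \<rho> (src X e)"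
  proof -
    let ?M = "Max ((\<lambda>e. \<rho> (src X e)) ` set c)"
    have "?M \<in> (\<lambda>e. \<rho> (src X e)) ` set c" using c(1) by (intro Max_in) auto
    then obtain e where "e \<in> set c" "\<rho> (src X e) = ?M" by auto
    then show ?thesis using that by (metis List.finite_set Max_ge finite_imageI imageI)
  qed
  obtain i where i: "i < length c" "e = c ! i" using e by (metis in_set_conv_nth)
  have in_src: "\<exists>f\<in>set c. tgt X f = src X e" 
  proof (cases i)
    case 0
    then show ?thesis using c i by (metis hd_conv_nth last_in_set)
  next
    case (Suc j)
    then show ?thesis using c i by (metis Suc_lessD nth_mem)
  qed
  have out_src: "\<exists>f\<in>set c. tgt X e = src X f"
  proof (cases "Suc i < length c")
    case True
    then show ?thesis using c i by (metis nth_mem)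
  next
    case False
    then have "e = last c" using i c(1) by (metis Suc_lessI diff_Suc_1 last_conv_nth)
    then show ?thesis using c by (metis hd_in_set)
  qed
  obtain f where f: "f \<in> set c" "tgt X f = src X e" using in_src by auto
  have "e = \<sigma> (src X e)" using edge[OF e(1)] out_src e(2) by fastforce
  moreover have "f = einv X (\<sigma> (src X e))" using edge[OF f(1)] f e(2)[OF f(1)] by auto
  ultimately show False using c(5)[OF e(1)] f by simp
qed

text \<open>
  If two arborescences with equal support disagreed at a vertex, then there the second one
  would reverse an edge chosen by the first one at the next vertex; by induction on the rank
  both agree at that next vertex, so the second one would go back and forth.
\<close>
lemma inj_on_support: "inj_on (support X w) (arborescences X w)"
proof (rule inj_onI)
  fix \<sigma> \<tau> assume st: "\<sigma> \<in> arborescences X w" "\<tau> \<in> arborescences X w" "support X w \<sigma> = support X w \<tau>"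
  have \<sigma>: "\<sigma> v \<in> edges X" "src X (\<sigma> v) = v" if "v \<in> verts X - {w}" for v
    using st(1) that by (auto simp: arborescences_def Pi_iff)
  obtain \<rho> :: "'v \<Rightarrow> nat" where \<tau>: "\<And>v. v \<in> verts X - {w} \<Longrightarrow> \<tau> v \<in> edges X \<and> src X (\<tau> v) = v"
    and \<rho>: "\<And>v. v \<in> verts X - {w} \<Longrightarrow> \<rho> (tgt X (\<tau> v)) < \<rho> v"
    using st(2) by (auto simp: arborescences_def Pi_iff)
  \<comment> \<open>the induction runs over the rank of the second arborescence\<close>
  have "\<tau> v = \<sigma> v" if "v \<in> verts X - {w}" for v
    using that
  proof (induction "\<rho> v" arbitrary: v rule: less_induct)
    case less
    note v = less.prems
    have "\<tau> v \<in> \<Union> (support X w \<sigma>)" using v st(3) by (auto simp: support_def)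
    then obtain x where x: "x \<in> verts X - {w}" "\<tau> v = \<sigma> x \<or> \<tau> v = einv X (\<sigma> x)"
      by (auto simp: support_def)
    show ?case
      using x(2)
    proof
      assume "\<tau> v = \<sigma> x"
      then show ?thesis using \<tau>[OF v] \<sigma>[OF x(1)] by simp
    next
      assume rev: "\<tau> v = einv X (\<sigma> x)"
      then have tx: "tgt X (\<tau> v) = x" and sx: "tgt X (\<sigma> x) = v"
        using \<sigma>[OF x(1)] \<tau>[OF v] by (auto simp: tgt_einv src_einv)
      have lt: "\<rho> x < \<rho> v" using \<rho>[OF v] tx by simp
      have "\<rho> v < \<rho> x" using less.hyps[OF lt x(1)] sx \<rho>[OF x(1)] by simp
      with lt show ?thesis by simp
    qed
  qed
  moreover have "\<sigma> \<in> extensional (verts X - {w})" "\<tau> \<in> extensional (verts X - {w})"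
    using st by (auto simp: arborescences_def PiE_def)
  ultimately show "\<sigma> = \<tau>" by (metis extensionalityI)
qed

text \<open>
  In a spanning tree, choose at each vertex an edge that decreases the distance to the root.
  An edge of the tree outside the support would close a circuit together with a simple walk
  in the support between its ends.
\<close>
lemma spanning_tree_is_support:
  assumes w: "w \<in> verts X" and S: "S \<in> spanning_trees X"
  shows "\<exists>\<sigma>\<in>arborescences X w. support X w \<sigma> = S"
proof -
  have SE: "S \<subseteq> undirected_edges X" and conn: "connected_graph (X\<lparr>edges := \<Union>S\<rparr>)"
    and nc: "\<And>c. \<not> circuit (X\<lparr>edges := \<Union>S\<rparr>) c"
    using S by (auto simp: spanning_trees_def tree_graph_def)
  have US: "\<Union>S \<subseteq> edges X" using SE by (auto simp: undirected_edges_def einv_in)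
  have pairS: "{e, einv X e} \<in> S" if "e \<in> \<Union>S" for e
  proof -
    obtain s where s: "s \<in> S" "e \<in> s" using \<open>e \<in> \<Union>S\<close> by blast
    then obtain f where "f \<in> edges X" "s = {f, einv X f}"
      using SE by (auto simp: undirected_edges_def)
    with s show ?thesis using einv_einv[of f] by (auto simp: insert_commute)
  qed
  define R where "R = {(src X e, tgt X e) | e. e \<in> \<Union>S}"
  define \<delta> where "\<delta> v = (LEAST n. (v, w) \<in> R ^^ n)" for v
  have ex: "\<exists>e. e \<in> \<Union>S \<and> src X e = v \<and> \<delta> (tgt X e) < \<delta> v" if v: "v \<in> verts X - {w}" for v
  proof -
    have "(v, w) \<in> R\<^sup>*" using conn v w unfolding connected_graph_restrict R_def by blast
    then obtain n where "(v, w) \<in> R ^^ n" by (auto simp: rtrancl_power)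
    then have vn: "(v, w) \<in> R ^^ \<delta> v" unfolding \<delta>_def by (rule LeastI)
    with v obtain k where k: "\<delta> v = Suc k" by (cases "\<delta> v") auto
    obtain x where x: "(v, x) \<in> R" "(x, w) \<in> R ^^ k"
      using vn unfolding k by (meson relpow_Suc_E2)
    have "\<delta> x \<le> k" unfolding \<delta>_def using x(2) by (rule Least_le)
    then show ?thesis using x(1) k unfolding R_def by auto
  qed
  define \<sigma> where "\<sigma> = (\<lambda>v\<in>verts X - {w}. SOME e. e \<in> \<Union>S \<and> src X e = v \<and> \<delta> (tgt X e) < \<delta> v)"
  have \<sigma>: "\<sigma> v \<in> \<Union>S" "src X (\<sigma> v) = v" "\<delta> (tgt X (\<sigma> v)) < \<delta> v" if "v \<in> verts X - {w}" for v
    using someI_ex[OF ex[OF that]] that unfolding \<sigma>_def by auto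
  have arb: "\<sigma> \<in> arborescences X w"
  proof -
    have "\<sigma> \<in> extensional (verts X - {w})" by (auto simp: \<sigma>_def)
    then show ?thesis
      using \<sigma> US unfolding arborescences_def PiE_def by (auto intro!: exI[of _ \<delta>])
  qed
  define E where "E = \<Union> (support X w \<sigma>)"
  have sub: "support X w \<sigma> \<subseteq> S" using \<sigma>(1) pairS by (auto simp: support_def)
  have "S \<subseteq> support X w \<sigma>"
  proof
    fix s assume s: "s \<in> S"
    then obtain e where e: "e \<in> edges X" "s = {e, einv X e}" using SE by (auto simp: undirected_edges_def)
    show "s \<in> support X w \<sigma>"
    proof (rule ccontr)
      assume ns: "s \<notin> support X w \<sigma>"
      have eE: "e \<notin> E"
      proof
        assume "e \<in> E"
        then obtain v where v: "v \<in> verts X - {w}" "e = \<sigma> v \<or> e = einv X (\<sigma> v)"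
          by (auto simp: E_def support_def)
        moreover have "\<sigma> v \<in> edges X" using \<sigma>(1)[OF v(1)] US by auto
        ultimately have "s = {\<sigma> v, einv X (\<sigma> v)}" using e einv_einv by auto
        then show False using ns v(1) by (auto simp: support_def)
      qed
      have ieE: "einv X e \<notin> E"
        using eE support_edges(3)[OF arb, of "einv X e"] einv_einv[OF e(1)] by (auto simp: E_def)
      have "(tgt X e, src X e) \<in> {(src X e, tgt X e) | e. e \<in> E}\<^sup>*"
        using support_connected[OF w arb] src_in[OF e(1)] tgt_in[OF e(1)]
        unfolding connected_graph_restrict E_def by blast
      from simple_walk_exists[OF this] obtain c where c: "set c \<subseteq> E" "walk X (tgt X e) c (src X e)"
          "distinct (map (src X) c @ [src X e])"
        by blast
      have cX: "set c \<subseteq> edges X" using c(1) support_edges(1)[OF arb] by (auto simp: E_def)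
      \<comment> \<open>the reverse of \<open>f\<close> could only be the next step of the walk, which would then revisit the source of \<open>f\<close>\<close>
      have no_rev: "einv X f \<notin> set c" if f: "f \<in> set c" for f
      proof
        assume g: "einv X f \<in> set c"
        have fX: "f \<in> edges X" using f cX by auto
        obtain i where i: "i < length c" "f = c ! i" using f by (metis in_set_conv_nth)
        have cne: "c \<noteq> []" using i by auto
        have "src X (einv X f) = tgt X f" using src_einv fX by simp
        have "Suc i < length c"
        proof (rule ccontr)
          assume "\<not> Suc i < length c"
          then have "f = last c" using i by (metis Suc_lessI diff_Suc_1 last_conv_nth list.size(3) not_less_zero)
          then have "tgt X f = src X e" using walk_steps(2)[OF c(2) cne] i by auto
          then show False using g c(3) \<open>src X (einv X f) = tgt X f\<close> by (auto simp: image_iff)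
        qed
        then have next_src: "src X (c ! Suc i) = src X (einv X f)"
          using walk_steps(1)[OF c(2)] i \<open>src X (einv X f) = tgt X f\<close> by simp
        have "inj_on (src X) (set c)" using c(3) by (simp add: distinct_map)
        then have nf: "c ! Suc i = einv X f"
          using next_src g nth_mem[OF \<open>Suc i < length c\<close>] by (auto dest: inj_onD)
        have "tgt X (c ! Suc i) = src X f" unfolding nf using tgt_einv fX by simp
        show False
        proof (cases "Suc (Suc i) < length c")
          case True
          then have "src X (c ! Suc (Suc i)) = src X (c ! i)"
            using walk_steps(1)[OF c(2) True] \<open>tgt X (c ! Suc i) = src X f\<close> i by simp
          then have "map (src X) c ! Suc (Suc i) = map (src X) c ! i" using True by simp
          moreover have "distinct (map (src X) c)" using c(3) by simp
          ultimately show False using True nth_eq_iff_index_eq[of "map (src X) c" "Suc (Suc i)" i] by simp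
        next
          case False
          then have "c ! Suc i = last c" using \<open>Suc i < length c\<close>
            by (metis Suc_lessI diff_Suc_1 last_conv_nth list.size(3) not_less_zero)
          then have "src X f = src X e"
            using walk_steps(2)[OF c(2) cne] i \<open>tgt X (c ! Suc i) = src X f\<close> by auto
          then show False using f c(3) by (auto simp: image_iff)
        qed
      qed
      have wk: "walk X (src X e) (e # c) (src X e)" using c(2) by simp
      have "circuit (X\<lparr>edges := \<Union>S\<rparr>) (e # c)"
        unfolding circuit_def
      proof (intro conjI)
        show "set (e # c) \<subseteq> edges (X\<lparr>edges := \<Union>S\<rparr>)"
          using c(1) sub e s unfolding E_def by auto
        show "\<forall>i. Suc i < length (e # c) \<longrightarrow>
            tgt (X\<lparr>edges := \<Union>S\<rparr>) ((e # c) ! i) = src (X\<lparr>edges := \<Union>S\<rparr>) ((e # c) ! Suc i)"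
          using walk_steps(1)[OF wk] by simp
        show "tgt (X\<lparr>edges := \<Union>S\<rparr>) (last (e # c)) = src (X\<lparr>edges := \<Union>S\<rparr>) (hd (e # c))"
          using walk_steps(2)[OF wk] by simp
        show "distinct (map (src (X\<lparr>edges := \<Union>S\<rparr>)) (e # c))" using c(3) by auto
        show "\<forall>f\<in>set (e # c). einv (X\<lparr>edges := \<Union>S\<rparr>) f \<notin> set (e # c)"
        proof
          fix f assume "f \<in> set (e # c)"
          then consider "f = e" | "f \<in> set c" by auto
          then show "einv (X\<lparr>edges := \<Union>S\<rparr>) f \<notin> set (e # c)"
          proof cases
            case 1
            then show ?thesis using einv_neq[OF e(1)] ieE c(1) by auto
          next
            case 2
            then have "einv X f \<noteq> e"
              using support_edges(3)[OF arb, of f] c(1) eE by (auto simp: E_def)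
            then show ?thesis using no_rev[OF 2] by simp
          qed
        qed
      qed simp
      then show False using nc by blast
    qed
  qed
  with sub arb show ?thesis by blast
qed

lemma bij_betw_support:
  assumes "w \<in> verts X"
  shows "bij_betw (support X w) (arborescences X w) (spanning_trees X)"
  unfolding bij_betw_def
proof
  show "support X w ` arborescences X w = spanning_trees X"
  proof
    show "support X w ` arborescences X w \<subseteq> spanning_trees X"
      using support_edges(2) support_connected[OF assms] support_no_circuit
      by (auto simp: spanning_trees_def tree_graph_def)
    show "spanning_trees X \<subseteq> support X w ` arborescences X w"
      using spanning_tree_is_support[OF assms] by blast
  qed
qed (rule inj_on_support)

end

text \<open>
  With a decreasing rank, a permutation with a nonzero term in the Leibniz expansion never
  increases the rank, so it is the identity. Without one, some vertices never reach the root, and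
  their indicator vector lies in the kernel. The matrix is the reduced Laplacian for one chosen
  edge at each vertex.
\<close>
lemma det_functional_laplacian:
  fixes nxt :: "'v \<Rightarrow> 'v" and b :: "nat \<Rightarrow> 'v"
  assumes b: "bij_betw b {..<N} (V - {w})" and nxt: "\<And>v. v \<in> V - {w} \<Longrightarrow> nxt v \<in> V"
  shows "det (mat N N (\<lambda>(i, j). of_bool (i = j) - of_bool (nxt (b i) = b j)) :: int mat) =
           of_bool (\<exists>\<rho> :: 'v \<Rightarrow> nat. \<forall>v\<in>V - {w}. \<rho> (nxt v) < \<rho> v)"
proof -
  define A :: "int mat" where "A = mat N N (\<lambda>(i, j). of_bool (i = j) - of_bool (nxt (b i) = b j))"
  have A: "A \<in> carrier_mat N N" by (simp add: A_def)
  have Aij: "A $$ (i, j) = of_bool (i = j) - of_bool (nxt (b i) = b j)" if "i < N" "j < N" for i j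
    using that by (simp add: A_def)
  have bV: "b i \<in> V - {w}" if "i < N" for i using b that by (auto simp: bij_betw_def)
  show ?thesis
  proof (cases "\<exists>\<rho> :: 'v \<Rightarrow> nat. \<forall>v\<in>V - {w}. \<rho> (nxt v) < \<rho> v")
    case True
    then obtain \<rho> :: "'v \<Rightarrow> nat" where \<rho>: "\<And>v. v \<in> V - {w} \<Longrightarrow> \<rho> (nxt v) < \<rho> v" by blast
    have other: "(\<Prod>i = 0..<N. A $$ (i, \<pi> i)) = 0" if \<pi>: "\<pi> permutes {0..<N}" "\<pi> \<noteq> id" for \<pi>
    proof (rule ccontr)
      assume nz: "(\<Prod>i = 0..<N. A $$ (i, \<pi> i)) \<noteq> 0"
      have entry: "\<pi> i = i \<or> \<rho> (b (\<pi> i)) < \<rho> (b i)" if "i < N" for i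
      proof -
        have "A $$ (i, \<pi> i) \<noteq> 0" using nz that by simp
        moreover have "\<pi> i < N" using permutes_in_image[OF \<pi>(1), of i] that by simp
        ultimately have "\<pi> i = i \<or> nxt (b i) = b (\<pi> i)"
          using Aij[OF that] by (auto simp: of_bool_def split: if_splits)
        then show ?thesis using \<rho>[OF bV[OF that]] by auto
      qed
      obtain i where i: "i < N" "\<pi> i \<noteq> i"
        using \<pi> by (auto simp: permutes_def fun_eq_iff)
      have "(\<Sum>i = 0..<N. \<rho> (b (\<pi> i))) < (\<Sum>i = 0..<N. \<rho> (b i))"
      proof (rule sum_strict_mono_ex1)
        show "\<forall>x\<in>{0..<N}. \<rho> (b (\<pi> x)) \<le> \<rho> (b x)"
          using entry by (metis atLeastLessThan_iff le_refl less_imp_le_nat)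
        show "\<exists>x\<in>{0..<N}. \<rho> (b (\<pi> x)) < \<rho> (b x)"
          using entry[OF i(1)] i by auto
      qed simp
      moreover have "(\<Sum>i = 0..<N. \<rho> (b (\<pi> i))) = (\<Sum>i = 0..<N. \<rho> (b i))"
        using sum.permute[OF \<pi>(1), of "\<lambda>i. \<rho> (b i)"] by (simp add: o_def)
      ultimately show False by simp
    qed
    have "det A = (\<Sum>\<pi> | \<pi> permutes {0..<N}. signof \<pi> * (\<Prod>i = 0..<N. A $$ (i, \<pi> i)))"
      by (rule det_def'[OF A])
    also have "\<dots> = (\<Sum>\<pi>\<in>{id}. signof \<pi> * (\<Prod>i = 0..<N. A $$ (i, \<pi> i)))"
      by (intro sum.mono_neutral_right) (auto simp: finite_permutations other)
    also have "\<dots> = (\<Prod>i = 0..<N. A $$ (i, i))" by simp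
    also have "\<dots> = 1"
    proof (intro prod.neutral ballI)
      fix i assume "i \<in> {0..<N}"
      then have i: "i < N" by simp
      have "nxt (b i) \<noteq> b i" using \<rho>[OF bV[OF i]] by auto
      then show "A $$ (i, i) = 1" using Aij[OF i i] by simp
    qed
    finally show ?thesis using True by (simp add: A_def)
  next
    case False
    define reach where "reach v \<longleftrightarrow> (\<exists>k. (nxt ^^ k) v = w)" for v
    have reach_nxt: "reach (nxt v) \<longleftrightarrow> reach v" if "v \<noteq> w" for v
    proof
      assume "reach (nxt v)"
      then show "reach v" unfolding reach_def by (metis comp_apply funpow_Suc_right)
    next
      assume "reach v"
      then obtain k where "(nxt ^^ k) v = w" unfolding reach_def by blast
      with that show "reach (nxt v)" unfolding reach_def
        by (cases k) (auto simp: funpow_Suc_right simp del: funpow.simps)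
    qed
    have "\<exists>v\<in>V - {w}. \<not> reach v"
    proof (rule ccontr)
      assume *: "\<not> ?thesis"
      define \<rho> where "\<rho> v = (LEAST k. (nxt ^^ k) v = w)" for v
      have "\<rho> (nxt v) < \<rho> v" if v: "v \<in> V - {w}" for v
      proof -
        have "\<exists>k. (nxt ^^ k) v = w" using * v unfolding reach_def by blast
        then have "(nxt ^^ \<rho> v) v = w" unfolding \<rho>_def by (rule LeastI_ex)
        moreover from this obtain k where k: "\<rho> v = Suc k" using v by (cases "\<rho> v") auto
        ultimately have "(nxt ^^ k) (nxt v) = w" by (simp add: funpow_Suc_right del: funpow.simps)
        then have "\<rho> (nxt v) \<le> k" unfolding \<rho>_def by (rule Least_le)
        then show ?thesis using k by simp
      qed
      then show False using False by blast
    qed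
    then obtain v where v: "v \<in> V - {w}" "\<not> reach v" by blast
    then have "v \<in> b ` {..<N}" unfolding bij_betw_imp_surj_on[OF b] by blast
    then obtain i0 where i0: "i0 < N" "b i0 = v" by auto
    define x :: "int vec" where "x = vec N (\<lambda>i. of_bool (\<not> reach (b i)))"
    have "x \<in> carrier_vec N" by (simp add: x_def)
    moreover have "x \<noteq> 0\<^sub>v N"
    proof
      assume "x = 0\<^sub>v N"
      then have "x $ i0 = 0" using i0 by simp
      then show False using i0 v by (simp add: x_def)
    qed
    moreover have "A *\<^sub>v x = 0\<^sub>v N"
    proof (rule eq_vecI)
      fix i assume "i < dim_vec (0\<^sub>v N :: int vec)"
      then have i: "i < N" by simp
      have "(A *\<^sub>v x) $ i = (\<Sum>j = 0..<N. A $$ (i, j) * x $ j)"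
        using i A by (simp add: scalar_prod_def x_def)
      also have "\<dots> = (\<Sum>j = 0..<N. of_bool (i = j) * of_bool (\<not> reach (b j)))
          - (\<Sum>j = 0..<N. of_bool (nxt (b i) = b j) * of_bool (\<not> reach (b j)))"
        unfolding sum_subtractf[symmetric]
        by (intro sum.cong) (auto simp: Aij i x_def left_diff_distrib)
      also have "(\<Sum>j = 0..<N. of_bool (i = j) * of_bool (\<not> reach (b j))) =
          (of_bool (\<not> reach (b i)) :: int)"
      proof -
        have "(\<Sum>j = 0..<N. of_bool (i = j) * of_bool (\<not> reach (b j))) =
            (\<Sum>j = 0..<N. if i = j then of_bool (\<not> reach (b i)) else (0 :: int))"
          by (intro sum.cong) auto
        then show ?thesis using i by simp
      qed
      also have "(\<Sum>j = 0..<N. of_bool (nxt (b i) = b j) * of_bool (\<not> reach (b j))) =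
          (of_bool (\<not> reach (nxt (b i))) :: int)"
      proof (cases "nxt (b i) = w")
        case True
        then have "nxt (b i) \<noteq> b j" if "j < N" for j using bV[OF that] by auto
        moreover have "reach (nxt (b i))" unfolding reach_def True by (rule exI[of _ 0]) simp
        ultimately show ?thesis by simp
      next
        case False
        then have "nxt (b i) \<in> b ` {..<N}"
          unfolding bij_betw_imp_surj_on[OF b] using nxt[OF bV[OF i]] by blast
        then obtain j0 where j0: "j0 < N" "b j0 = nxt (b i)" by auto
        have "nxt (b i) = b j \<longleftrightarrow> j0 = j" if "j < N" for j
          using inj_onD[OF bij_betw_imp_inj_on[OF b], of j0 j] j0 that by auto
        then have "(\<Sum>j = 0..<N. of_bool (nxt (b i) = b j) * of_bool (\<not> reach (b j)))
            = (\<Sum>j = 0..<N. if j0 = j then of_bool (\<not> reach (nxt (b i))) else (0 :: int))"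
          using j0 by (intro sum.cong) auto
        then show ?thesis using j0 by simp
      qed
      also have "reach (nxt (b i)) \<longleftrightarrow> reach (b i)" using reach_nxt bV[OF i] by auto
      finally show "(A *\<^sub>v x) $ i = 0\<^sub>v N $ i" using i by simp
    qed (use A in simp)
    ultimately have "det A = 0" using det_0_iff_vec_prod_zero[OF A] by blast
    then show ?thesis using False by (simp add: A_def)
  qed
qed

context serre_graph
begin

text \<open>
  Kirchhoff's matrix-tree theorem. Each row of the reduced Laplacian is a sum over the edges
  leaving a vertex, so multilinearity turns the determinant into a sum over all choices of one
  outgoing edge per vertex. A choice contributes 1 if it is an arborescence and 0 otherwise,
  and the arborescences correspond to the spanning trees.
\<close>
theorem matrix_tree:
  assumes w: "w \<in> verts X" and b: "bij_betw b {..<N} (verts X - {w})"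
  shows "int (num_spanning_trees X) =
    det (mat N N (\<lambda>(i, j). \<Sum>e | e \<in> edges X \<and> src X e = b i.
           of_bool (i = j) - of_bool (tgt X e = b j)))"
proof -
  define V where "V = verts X - {w}"
  define out where "out v = {e \<in> edges X. src X e = v}" for v
  have fin: "finite (out v)" for v using finite_edges by (simp add: out_def)
  have finV: "finite V" using finite_verts by (simp add: V_def)
  have bV: "b i \<in> V" if "i < N" for i using b that by (auto simp: bij_betw_def V_def)
  define A :: "int mat" where
    "A = mat N N (\<lambda>(i, j). \<Sum>e\<in>out (b i). of_bool (i = j) - of_bool (tgt X e = b j))"
  define B :: "('v \<Rightarrow> 'e) \<Rightarrow> int mat" where
    "B \<sigma> = mat N N (\<lambda>(i, j). of_bool (i = j) - of_bool (tgt X (\<sigma> (b i)) = b j))" for \<sigma>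
  \<comment> \<open>a matrix entry as a function of a vertex, so that \<open>prod_sum_PiE\<close> applies to choice functions on vertices\<close>
  define F :: "(nat \<Rightarrow> nat) \<Rightarrow> 'v \<Rightarrow> 'e \<Rightarrow> int" where
    "F \<pi> v e = of_bool (inv_into {..<N} b v = \<pi> (inv_into {..<N} b v))
        - of_bool (tgt X e = b (\<pi> (inv_into {..<N} b v)))" for \<pi> v e
  have inv: "inv_into {..<N} b (b i) = i" if "i < N" for i
    using b that by (simp add: bij_betw_inv_into_left)
  have b': "bij_betw b {0..<N} V" using b by (simp add: V_def atLeast0LessThan)
  have expand: "(\<Prod>i = 0..<N. A $$ (i, \<pi> i)) = (\<Sum>\<sigma>\<in>Pi\<^sub>E V out. \<Prod>i = 0..<N. B \<sigma> $$ (i, \<pi> i))"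
    if \<pi>: "\<pi> permutes {0..<N}" for \<pi>
  proof -
    have \<pi>N: "\<pi> i < N" if "i < N" for i using permutes_in_image[OF \<pi>, of i] that by simp
    have "(\<Prod>i = 0..<N. A $$ (i, \<pi> i)) = (\<Prod>i = 0..<N. \<Sum>e\<in>out (b i). F \<pi> (b i) e)"
      by (intro prod.cong) (auto simp: A_def F_def inv \<pi>N)
    also have "\<dots> = (\<Prod>v\<in>V. \<Sum>e\<in>out v. F \<pi> v e)"
      by (rule prod.reindex_bij_betw[OF b'])
    also have "\<dots> = (\<Sum>\<sigma>\<in>Pi\<^sub>E V out. \<Prod>v\<in>V. F \<pi> v (\<sigma> v))"
      by (rule prod_sum_PiE[OF finV fin])
    also have "\<dots> = (\<Sum>\<sigma>\<in>Pi\<^sub>E V out. \<Prod>i = 0..<N. F \<pi> (b i) (\<sigma> (b i)))"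
      by (simp add: prod.reindex_bij_betw[OF b', symmetric])
    also have "\<dots> = (\<Sum>\<sigma>\<in>Pi\<^sub>E V out. \<Prod>i = 0..<N. B \<sigma> $$ (i, \<pi> i))"
      by (intro sum.cong prod.cong) (auto simp: B_def F_def inv \<pi>N)
    finally show ?thesis .
  qed
  have "det A = (\<Sum>\<pi> | \<pi> permutes {0..<N}. \<Sum>\<sigma>\<in>Pi\<^sub>E V out.
      signof \<pi> * (\<Prod>i = 0..<N. B \<sigma> $$ (i, \<pi> i)))"
    by (subst det_def'[of _ N]) (auto simp: A_def[symmetric] expand sum_distrib_left intro!: sum.cong, simp add: A_def)
  also have "\<dots> = (\<Sum>\<sigma>\<in>Pi\<^sub>E V out. det (B \<sigma>))"
    by (subst sum.swap) (simp add: det_def'[of _ N] B_def)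
  also have "\<dots> = (\<Sum>\<sigma>\<in>Pi\<^sub>E V out. of_bool (\<exists>\<rho> :: 'v \<Rightarrow> nat. \<forall>v\<in>V. \<rho> (tgt X (\<sigma> v)) < \<rho> v))"
  proof (intro sum.cong refl)
    fix \<sigma> assume \<sigma>: "\<sigma> \<in> Pi\<^sub>E V out"
    have "tgt X (\<sigma> v) \<in> verts X" if "v \<in> verts X - {w}" for v
      using \<sigma> that tgt_in by (auto simp: PiE_iff V_def out_def)
    then show "det (B \<sigma>) = of_bool (\<exists>\<rho> :: 'v \<Rightarrow> nat. \<forall>v\<in>V. \<rho> (tgt X (\<sigma> v)) < \<rho> v)"
      unfolding B_def V_def by (intro det_functional_laplacian[OF b])
  qed
  also have "\<dots> = int (card (arborescences X w))"
    using finV fin by (simp add: finite_PiE arborescences_def V_def out_def[abs_def] Int_def)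
  also have "card (arborescences X w) = num_spanning_trees X"
    unfolding num_spanning_trees_def by (rule bij_betw_same_card[OF bij_betw_support[OF w]])
  finally show ?thesis by (simp add: A_def out_def)
qed

end


section \<open>Circulant determinants\<close>

definition zeta :: "nat \<Rightarrow> nat \<Rightarrow> complex" where
  "zeta q k = cis (2 * pi * real k / real q)"

lemma zeta_pow: "q > 0 \<Longrightarrow> zeta q k ^ q = 1"
  by (simp add: zeta_def Complex.DeMoivre)

lemma zeta_nonzero [simp]: "zeta q k \<noteq> 0"
  by (simp add: zeta_def)

lemma zeta_powi: "zeta q k powi a = cis (2 * pi * real k * of_int a / real q)"
  by (simp add: zeta_def cis_power_int mult_ac)

lemma zeta_powi_mod:
  assumes "q > 0"
  shows "zeta q k powi (a mod int q) = zeta q k powi a"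
proof -
  have "zeta q k powi a = zeta q k powi (int q * (a div int q) + a mod int q)" by simp
  also have "\<dots> = (zeta q k powi int q) powi (a div int q) * zeta q k powi (a mod int q)"
    unfolding power_int_mult[symmetric] by (rule power_int_add) simp
  also have "zeta q k powi int q = 1" using zeta_pow[OF assms] by simp
  finally show ?thesis by simp
qed

lemma zeta_eq_1_iff:
  assumes "q > 0"
  shows "zeta q k = 1 \<longleftrightarrow> q dvd k"
proof
  assume "zeta q k = 1"
  then have "cos (2 * pi * real k / real q) = 1" by (simp add: zeta_def complex_eq_iff)
  then obtain n :: int where "2 * pi * real k / real q = of_int n * 2 * pi"
    using cos_one_2pi_int by blast
  then have "real k = of_int n * real q" using assms by (simp add: field_simps)
  then have "int k = n * int q" by (metis of_int_eq_iff of_int_mult of_int_of_nat_eq)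
  then show "q dvd k" by (metis dvd_triv_right int_dvd_int_iff)
next
  assume "q dvd k"
  then obtain n where "k = q * n" by blast
  then have "2 * pi * real k / real q = 2 * pi * real n" using assms by simp
  then show "zeta q k = 1" by (simp only: zeta_def cis_multiple_2pi Ints_of_nat)
qed

lemma zeta_power: "q > 0 \<Longrightarrow> zeta q k ^ m = zeta q (k * m)"
  by (simp add: zeta_def Complex.DeMoivre field_simps)

lemma zeta_mult: "zeta q j * zeta q k = zeta q (j + k)"
  by (simp add: zeta_def cis_mult add_divide_distrib[symmetric] distrib_left)

text \<open>
  The matrix of multiplication by \<open>\<Sum>t\<in>T. c t * \<gamma>^(a t)\<close> on the group ring of the integers
  modulo \<open>q\<close>, where \<open>\<gamma>\<close> is a generator. An arbitrary index set \<open>T\<close> covers both integer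
  polynomials and the Laplacians of Cayley graphs with loops and multiple edges.
\<close>
definition circulant :: "nat \<Rightarrow> 't set \<Rightarrow> ('t \<Rightarrow> int) \<Rightarrow> ('t \<Rightarrow> int) \<Rightarrow> int mat" where
  "circulant q T c a =
     mat q q (\<lambda>(i, j). \<Sum>t\<in>T. c t * of_bool (int j = (int i + a t) mod int q))"

lemma zeta_orthogonal:
  assumes "q > 0" "i < q" "j < q"
  shows "(\<Sum>k<q. zeta q (i * k) * cnj (zeta q (j * k))) = (if i = j then of_nat q else 0)"
proof -
  define x where "x = zeta q i * cnj (zeta q j)"
  have x: "zeta q (i * k) * cnj (zeta q (j * k)) = x ^ k" for k
    using assms(1) by (simp add: x_def power_mult_distrib zeta_power[symmetric])
  have xi: "x = cis (2 * pi * (real i - real j) / real q)"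
    by (simp add: x_def zeta_def cis_cnj cis_mult diff_divide_distrib right_diff_distrib)
  show ?thesis
  proof (cases "i = j")
    case True
    then show ?thesis using xi unfolding x by simp
  next
    case False
    have "x \<noteq> 1"
    proof
      assume "x = 1"
      then have "zeta q i * cnj (zeta q j) * zeta q j = zeta q j" unfolding x_def by simp
      moreover have "cnj (zeta q j) * zeta q j = 1" by (simp add: zeta_def cis_cnj cis_mult)
      ultimately have *: "zeta q i = zeta q j" by (simp add: mult.assoc)
      show False
      proof (cases "i < j")
        case True
        then have "zeta q i * zeta q (j - i) = zeta q j" unfolding zeta_mult by simp
        then have "q dvd j - i" using * zeta_eq_1_iff[OF assms(1)] by simp
        then show False using True assms by (auto dest: dvd_imp_le)
      next
        case False
        then have "zeta q j * zeta q (i - j) = zeta q i" unfolding zeta_mult by simp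
        then have "q dvd i - j" using * zeta_eq_1_iff[OF assms(1)] by simp
        then show False using False \<open>i \<noteq> j\<close> assms by (auto dest: dvd_imp_le)
      qed
    qed
    moreover have "x ^ q = 1"
      unfolding x_def power_mult_distrib complex_cnj_power[symmetric] using zeta_pow[OF assms(1)] by simp
    ultimately show ?thesis using False unfolding x by (simp add: geometric_sum)
  qed
qed

text \<open>
  The Fourier matrix diagonalises every circulant matrix, and it is invertible because it is
  orthogonal up to scaling.
\<close>
theorem det_circulant:
  assumes "q > 0" "finite T"
  shows "complex_of_int (det (circulant q T c a)) =
           (\<Prod>k<q. \<Sum>t\<in>T. of_int (c t) * zeta q k powi a t)"
proof -
  define f where "f k = (\<Sum>t\<in>T. of_int (c t) * zeta q k powi a t)" for k
  define A :: "complex mat" where "A = map_mat of_int (circulant q T c a)"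
  define V :: "complex mat" where "V = mat q q (\<lambda>(i, k). zeta q (i * k))"
  define W :: "complex mat" where "W = mat q q (\<lambda>(k, j). cnj (zeta q (j * k)))"
  define D :: "complex mat" where "D = mat q q (\<lambda>(i, k). if i = k then f k else 0)"
  have carr [simp]: "A \<in> carrier_mat q q" "V \<in> carrier_mat q q" "W \<in> carrier_mat q q" "D \<in> carrier_mat q q"
    by (auto simp: A_def V_def W_def D_def circulant_def)
  have "V * W = of_nat q \<cdot>\<^sub>m 1\<^sub>m q"
    using zeta_orthogonal[OF assms(1)]
    by (intro eq_matI) (auto simp: V_def W_def scalar_prod_def atLeast0LessThan)
  then have "det V * det W = of_nat q ^ q"
    using det_mult[of V q W] by simp
  then have V0: "det V \<noteq> 0" using assms(1) by auto
  have "A * V = V * D"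
  proof (rule eq_matI)
    fix i k assume "i < dim_row (V * D)" "k < dim_col (V * D)"
    then have ik: "i < q" "k < q" by (auto simp: V_def D_def)
    have "(A * V) $$ (i, k) =
        (\<Sum>j<q. \<Sum>t\<in>T. of_int (c t) * of_bool (int j = (int i + a t) mod int q) * zeta q (j * k))"
      using ik by (simp add: A_def V_def circulant_def scalar_prod_def atLeast0LessThan sum_distrib_right)
    also have "\<dots> = (\<Sum>t\<in>T. of_int (c t) * zeta q (nat ((int i + a t) mod int q) * k))"
    proof (subst sum.swap, rule sum.cong[OF refl])
      fix t assume "t \<in> T"
      define j0 where "j0 = nat ((int i + a t) mod int q)"
      have j0: "j0 < q" "int j = (int i + a t) mod int q \<longleftrightarrow> j = j0" for j
        using assms(1) by (auto simp: j0_def nat_less_iff)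
      then have "(\<Sum>j<q. of_int (c t) * of_bool (int j = (int i + a t) mod int q) * zeta q (j * k))
         = (\<Sum>j<q. if j = j0 then of_int (c t) * zeta q (j0 * k) else 0)"
        by (intro sum.cong) auto
      then show "(\<Sum>j<q. of_int (c t) * of_bool (int j = (int i + a t) mod int q) * zeta q (j * k))
          = of_int (c t) * zeta q (nat ((int i + a t) mod int q) * k)"
        using j0(1) by (simp add: j0_def)
    qed
    also have "\<dots> = (\<Sum>t\<in>T. zeta q (i * k) * (of_int (c t) * zeta q k powi a t))"
    proof (rule sum.cong[OF refl])
      fix t
      have "zeta q (nat ((int i + a t) mod int q) * k) = zeta q k ^ nat ((int i + a t) mod int q)"
        using assms(1) by (simp add: zeta_power mult.commute)
      also have "\<dots> = zeta q k powi ((int i + a t) mod int q)"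
        using assms(1) by (simp add: power_int_def)
      also have "\<dots> = zeta q k powi int i * zeta q k powi a t"
        by (simp add: zeta_powi_mod[OF assms(1)] power_int_add)
      also have "zeta q k powi int i = zeta q (i * k)"
        using assms(1) by (simp add: zeta_power mult.commute)
      finally show "of_int (c t) * zeta q (nat ((int i + a t) mod int q) * k) =
          zeta q (i * k) * (of_int (c t) * zeta q k powi a t)" by simp
    qed
    also have "\<dots> = zeta q (i * k) * f k" by (simp add: f_def sum_distrib_left)
    also have "\<dots> = (\<Sum>j<q. if j = k then zeta q (i * k) * f k else 0)" using ik by simp
    also have "\<dots> = (\<Sum>j<q. zeta q (i * j) * (if j = k then f k else 0))"
      by (intro sum.cong) auto
    also have "\<dots> = (V * D) $$ (i, k)"
      using ik by (simp add: V_def D_def scalar_prod_def atLeast0LessThan)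
    finally show "(A * V) $$ (i, k) = (V * D) $$ (i, k)" .
  qed (auto simp: A_def V_def D_def circulant_def)
  then have "det A * det V = det V * det D"
    by (metis carr(1,2,4) det_mult)
  then have "det A = det D" using V0 by simp
  also have "det D = prod_list (diag_mat D)"
    by (rule det_upper_triangular[of _ q]) (auto simp: D_def upper_triangular_def)
  also have "\<dots> = (\<Prod>k<q. f k)"
    by (simp add: diag_mat_def D_def prod.list_conv_set_nth atLeast0LessThan)
  finally show ?thesis by (simp add: A_def f_def)
qed


section \<open>Norms of integer polynomials\<close>

abbreviation xm1 :: "int poly" where "xm1 \<equiv> [:-1, 1:]"

definition ev :: "int poly \<Rightarrow> complex \<Rightarrow> complex" where
  "ev f z = poly (map_poly of_int f) z"

lemma ev_pCons [simp]: "ev (pCons a f) z = of_int a + z * ev f z"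
  by (simp add: ev_def map_poly_pCons)

lemma ev_0 [simp]: "ev 0 z = 0"
  by (simp add: ev_def)

lemma ev_1 [simp]: "ev 1 z = 1"
  by (simp add: one_pCons)

lemma ev_add [simp]: "ev (f + g) z = ev f z + ev g z"
  by (induction f g rule: poly_induct2) (simp_all add: algebra_simps)

lemma ev_smult [simp]: "ev (smult a f) z = of_int a * ev f z"
  by (induction f) (simp_all add: algebra_simps)

lemma ev_uminus [simp]: "ev (- f) z = - ev f z"
  using ev_smult[of "-1" f z] by simp

lemma ev_diff [simp]: "ev (f - g) z = ev f z - ev g z"
  using ev_add[of f "- g" z] by simp

lemma ev_mult [simp]: "ev (f * g) z = ev f z * ev g z"
  by (induction f) (simp_all add: algebra_simps)

lemma ev_power [simp]: "ev (f ^ n) z = ev f z ^ n"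
  by (induction n) simp_all

lemma ev_sum [simp]: "ev (sum f A) z = (\<Sum>a\<in>A. ev (f a) z)"
  by (induction A rule: infinite_finite_induct) simp_all

lemma ev_of_nat [simp]: "ev (of_nat n) z = of_nat n"
  by (induction n) simp_all

lemma ev_monom: "ev (monom 1 m) z = z ^ m"
  by (induction m) (simp_all add: monom_Suc)

lemma ev_altdef: "ev f z = (\<Sum>i\<le>degree f. of_int (coeff f i) * z ^ i)"
  by (simp add: ev_def poly_altdef degree_map_poly coeff_map_poly)

text \<open>
  The norm of \<open>f\<close>, that is, the resultant of \<open>x^q - 1\<close> and \<open>f\<close>. As a determinant it is an integer
  by construction; as a product over roots of unity it is multiplicative.
\<close>
definition cyc_norm :: "nat \<Rightarrow> int poly \<Rightarrow> int" where
  "cyc_norm q f = det (circulant q {..degree f} (coeff f) int)"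

lemma cyc_norm_eq_prod:
  "q > 0 \<Longrightarrow> complex_of_int (cyc_norm q f) = (\<Prod>k<q. ev f (zeta q k))"
  by (simp add: cyc_norm_def det_circulant ev_altdef)

lemma cyc_norm_mult: "q > 0 \<Longrightarrow> cyc_norm q (f * g) = cyc_norm q f * cyc_norm q g"
  by (simp add: cyc_norm_eq_prod prod.distrib flip: of_int_eq_iff[where 'a = complex])

lemma det_cong:
  assumes A: "A \<in> carrier_mat n n" and B: "B \<in> carrier_mat n n"
    and AB: "\<And>i j. i < n \<Longrightarrow> j < n \<Longrightarrow> [A $$ (i, j) = B $$ (i, j)] (mod m)"
  shows "[det A = det (B :: int mat)] (mod m)"
  unfolding det_def'[OF A] det_def'[OF B]
proof (intro cong_sum cong_mult cong_refl cong_prod)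
  fix \<pi> i assume "\<pi> \<in> {\<pi>. \<pi> permutes {0..<n}}" "i \<in> {0..<n}"
  then show "[A $$ (i, \<pi> i) = B $$ (i, \<pi> i)] (mod m)"
    using permutes_in_image[of \<pi> "{0..<n}" i] by (intro AB) auto
qed

lemma cyc_norm_cong_const:
  assumes "q > 0" and f: "f = [:c:] + of_nat p * g"
  shows "[cyc_norm q f = c ^ q] (mod int p)"
proof -
  define B :: "int mat" where "B = c \<cdot>\<^sub>m 1\<^sub>m q"
  have "[circulant q {..degree f} (coeff f) int $$ (i, j) = B $$ (i, j)] (mod int p)"
    if "i < q" "j < q" for i j
  proof -
    have coeff: "[coeff f t = (if t = 0 then c else 0)] (mod int p)" for t
      unfolding f of_nat_poly by (cases t) (simp_all add: cong_iff_dvd_diff coeff_pCons)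
    have "circulant q {..degree f} (coeff f) int $$ (i, j) =
        (\<Sum>t\<le>degree f. coeff f t * of_bool (int j = (int i + int t) mod int q))"
      using that by (simp add: circulant_def)
    also have "[\<dots> = (\<Sum>t\<le>degree f. (if t = 0 then c else 0) * of_bool (int j = (int i + int t) mod int q))] (mod int p)"
      by (intro cong_sum cong_mult coeff cong_refl)
    also have "(\<Sum>t\<le>degree f. (if t = 0 then c else 0) * of_bool (int j = (int i + int t) mod int q))
        = (\<Sum>t\<le>degree f. if t = 0 then c * of_bool (i = j) else 0)"
      using that by (intro sum.cong) auto
    also have "\<dots> = B $$ (i, j)" using that by (simp add: B_def)
    finally show ?thesis .
  qed
  then have "[cyc_norm q f = det B] (mod int p)"
    unfolding cyc_norm_def by (intro det_cong[of _ q]) (auto simp: circulant_def B_def)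
  then show ?thesis by (simp add: B_def)
qed

text \<open>
  The middle binomial coefficients are divisible by \<open>p\<close>. The error term is recorded as a multiple
  of \<open>t\<close> as well, which later permits division by \<open>t\<close>.
\<close>
lemma prime_power_one_add:
  fixes t :: "'a :: comm_ring_1"
  assumes "prime p"
  shows "\<exists>s. (t + 1) ^ p = 1 + t ^ p + of_nat p * t * s"
proof -
  have p: "p > 1" using prime_gt_1_nat[OF assms] .
  define s :: 'a where "s = (\<Sum>k\<in>{1..<p}. of_nat ((p choose k) div p) * t ^ (k - 1))"
  have "(t + 1) ^ p = (\<Sum>k\<le>p. of_nat (p choose k) * t ^ k)"
    by (simp add: binomial_ring)
  also have "{..p} = insert 0 (insert p {1..<p})" using p by auto
  also have "(\<Sum>k\<in>\<dots>. of_nat (p choose k) * t ^ k) =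
      1 + t ^ p + (\<Sum>k\<in>{1..<p}. of_nat (p choose k) * t ^ k)"
    using p by (simp add: add.assoc)
  also have "(\<Sum>k\<in>{1..<p}. of_nat (p choose k) * t ^ k) = of_nat p * t * s"
    unfolding s_def sum_distrib_left
  proof (intro sum.cong refl)
    fix k assume k: "k \<in> {1..<p}"
    then have "p dvd p choose k" using assms by (intro dvd_choose_prime) auto
    then have "of_nat (p choose k) = (of_nat p * of_nat ((p choose k) div p) :: 'a)"
      by (metis dvd_mult_div_cancel of_nat_mult)
    moreover have "t ^ k = t * t ^ (k - 1)" using k by (cases k) auto
    ultimately show "of_nat (p choose k) * t ^ k = of_nat p * t * (of_nat ((p choose k) div p) * t ^ (k - 1))"
      by (simp add: ac_simps)
  qed
  finally show ?thesis by blast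
qed

lemma diff_dvd_power_diff: "a - b dvd a ^ n - b ^ (n :: nat)" for a b :: "'a :: comm_ring_1"
  by (simp add: power_diff_sumr2)

lemma prime_power_power_one_add:
  fixes t :: "'a :: comm_ring_1"
  assumes "prime p"
  shows "of_nat p dvd (t + 1) ^ p ^ n - 1 - t ^ p ^ n"
proof (induction n)
  case (Suc n)
  define a b where "a = (t + 1) ^ p ^ n" and "b = t ^ p ^ n"
  obtain s where s: "(b + 1) ^ p = 1 + b ^ p + of_nat p * b * s"
    using prime_power_one_add[OF assms] by blast
  have "of_nat p dvd a - (b + 1)" using Suc by (simp add: a_def b_def algebra_simps)
  then have "of_nat p dvd (a ^ p - (b + 1) ^ p) + of_nat p * (b * s)"
    using diff_dvd_power_diff[of a "b + 1" p] by (intro dvd_add) (auto intro: dvd_trans)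
  also have "(a ^ p - (b + 1) ^ p) + of_nat p * (b * s) = a ^ p - 1 - b ^ p"
    unfolding s by (simp add: algebra_simps)
  finally show ?case by (simp add: a_def b_def mult.commute flip: power_mult)
qed simp

text \<open>
  Modulo \<open>p\<close> the polynomial \<open>x^(p^n) - 1\<close> is a power of \<open>x - 1\<close>, so that a norm modulo \<open>p\<close> only
  depends on the value at 1. Precisely, with \<open>e = f(1)\<close> the polynomial \<open>f\<close> divides
  \<open>e^q - (e - f)^q\<close>, and on the \<open>q\<close>-th roots of unity \<open>(e - f)^q\<close> is a multiple of
  \<open>(x - 1)^q\<close>, hence of \<open>p\<close>. So the norm of \<open>f\<close> divides a number congruent to a power of \<open>e\<close>.
\<close>
lemma cyc_norm_not_dvd:
  assumes "prime p" and nd: "\<not> int p dvd poly f 1"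
  shows "\<not> int p dvd cyc_norm (p ^ n) f"
proof
  assume dv: "int p dvd cyc_norm (p ^ n) f"
  define q e where "q = p ^ n" and "e = poly f 1"
  have q: "q > 0" using prime_gt_0_nat[OF assms(1)] by (simp add: q_def)
  have "poly (f - [:e:]) 1 = 0" by (simp add: e_def)
  then obtain s where s: "f - [:e:] = xm1 * s" unfolding poly_eq_0_iff_dvd by auto
  define y where "y = [:e:] - f"
  have "y = - (f - [:e:])" by (simp add: y_def)
  then have y: "y = xm1 * (- s)" unfolding s by (simp only: mult_minus_right)
  have "[:e:] - y dvd [:e:] ^ q - y ^ q" by (rule diff_dvd_power_diff)
  then obtain B where B: "[:e:] ^ q - y ^ q = f * B" by (auto simp: y_def)
  obtain u where u: "(xm1 + 1) ^ q - 1 - xm1 ^ q = of_nat p * u"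
    using prime_power_power_one_add[OF assms(1), of xm1 n] unfolding q_def by (elim dvdE)
  define F where "F = [:e ^ q:] + of_nat p * ((- s) ^ q * u)"
  have "ev (f * B) (zeta q k) = ev F (zeta q k)" for k
  proof -
    have "ev ((xm1 + 1) ^ q) (zeta q k) = 1" using zeta_pow[OF q] by simp
    then have neg: "- ev (xm1 ^ q) (zeta q k) = of_nat p * ev u (zeta q k)"
      using arg_cong[OF u, of "\<lambda>g. ev g (zeta q k)"] by simp
    have "ev (xm1 ^ q) (zeta q k) = - (of_nat p * ev u (zeta q k))"
      unfolding neg[symmetric] by simp
    moreover have "ev (y ^ q) (zeta q k) = ev (xm1 ^ q) (zeta q k) * ev ((- s) ^ q) (zeta q k)"
      unfolding y by (simp only: power_mult_distrib ev_mult)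
    ultimately show ?thesis
      unfolding B[symmetric] F_def
      by (simp add: poly_const_pow algebra_simps del: ev_power)
  qed
  then have "cyc_norm q (f * B) = cyc_norm q F"
    by (simp add: cyc_norm_eq_prod[OF q] flip: of_int_eq_iff[where 'a = complex])
  then have "int p dvd cyc_norm q F"
    using dv unfolding q_def[symmetric] by (metis cyc_norm_mult[OF q] dvd_mult2)
  moreover have "[cyc_norm q F = (e ^ q) ^ q] (mod int p)"
    by (rule cyc_norm_cong_const[OF q F_def])
  ultimately have "int p dvd (e ^ q) ^ q" by (simp add: cong_dvd_iff)
  then have "int p dvd e"
    using assms(1) by (metis prime_dvd_power prime_nat_int_transfer)
  then show False using nd by (simp add: e_def)
qed

text \<open>
  The sum on the right is the cyclotomic polynomial of order \<open>p^(n+1)\<close>. At a primitive root of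
  unity it vanishes, so there \<open>p\<close> and \<open>(x - 1)^\<phi>\<close> only differ by the factor \<open>w\<close>. The value of \<open>w\<close>
  at 1 is forced, because the cyclotomic polynomial takes the value \<open>p\<close> there; it makes the norms
  of \<open>w\<close> prime to \<open>p\<close>.
\<close>
lemma xm1_power_cong_cyclotomic:
  assumes "prime p"
  obtains w where "xm1 ^ (p ^ n * (p - 1)) = (\<Sum>k<p. monom 1 (p ^ n) ^ k) + of_nat p * w"
    and "poly w 1 = -1"
proof -
  have p: "p > 1" using prime_gt_1_nat[OF assms] .
  define y :: "int poly" where "y = monom 1 (p ^ n)"
  define t where "t = y - 1"
  define \<Phi> where "\<Phi> = (\<Sum>k<p. y ^ k)"
  have t0: "t \<noteq> 0"
  proof
    assume "t = 0"
    then have "degree y = degree (1 :: int poly)" by (simp add: t_def)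
    then show False using p by (simp add: y_def degree_monom_eq)
  qed
  obtain s where s: "(t + 1) ^ p = 1 + t ^ p + of_nat p * t * s"
    using prime_power_one_add[OF assms] by blast
  have "t * \<Phi> = (t + 1) ^ p - 1"
    by (simp add: \<Phi>_def t_def power_diff_1_eq)
  also have "\<dots> = t * (t ^ (p - 1) + of_nat p * s)"
    unfolding s using p by (simp add: algebra_simps flip: power_Suc)
  finally have \<Phi>: "\<Phi> = t ^ (p - 1) + of_nat p * s" using t0 by simp
  have "(xm1 + 1) ^ p ^ n = y" by (simp add: y_def monom_altdef one_pCons)
  then have "of_nat p dvd t - xm1 ^ p ^ n"
    using prime_power_power_one_add[OF assms, of xm1 n] by (simp add: t_def)
  then have "of_nat p dvd t ^ (p - 1) - (xm1 ^ p ^ n) ^ (p - 1)"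
    using diff_dvd_power_diff dvd_trans by blast
  then obtain u where u: "t ^ (p - 1) - (xm1 ^ p ^ n) ^ (p - 1) = of_nat p * u" by (elim dvdE)
  define w where "w = - (s + u)"
  have eq: "xm1 ^ (p ^ n * (p - 1)) = \<Phi> + of_nat p * w"
    unfolding power_mult using \<Phi> u by (simp add: w_def algebra_simps)
  have "poly (xm1 ^ (p ^ n * (p - 1))) 1 = poly \<Phi> 1 + int p * poly w 1"
    unfolding eq by (simp add: of_nat_poly)
  then have "0 = int p + int p * poly w 1"
    using p by (simp add: \<Phi>_def y_def poly_sum poly_monom power_0_left)
  then have "int p * (1 + poly w 1) = 0" by (simp add: algebra_simps)
  then have "poly w 1 = -1" using p by simp
  then show ?thesis by (rule that[OF eq[unfolded \<Phi>_def y_def]])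
qed

text \<open>
  The exponents of the roots of unity of exact order \<open>p^(n+1)\<close>.
\<close>
definition new_roots :: "nat \<Rightarrow> nat \<Rightarrow> nat set" where
  "new_roots p n = {k. k < p ^ Suc n \<and> \<not> p dvd k}"

lemma old_roots:
  assumes "p > 0"
  shows "bij_betw (\<lambda>k. p * k) {..<p ^ n} ({..<p ^ Suc n} - new_roots p n)"
proof -
  have "{..<p ^ Suc n} - new_roots p n = (\<lambda>k. p * k) ` {..<p ^ n}"
    using assms by (auto simp: new_roots_def elim!: dvdE)
  then show ?thesis using assms by (simp add: bij_betw_def inj_on_def)
qed

text \<open>
  The roots of unity of order dividing \<open>p^n\<close> are those with an exponent divisible by \<open>p\<close>; the
  others are new.
\<close>
lemma cyc_norm_Suc:
  assumes "p > 0"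
  shows "complex_of_int (cyc_norm (p ^ Suc n) f) =
    of_int (cyc_norm (p ^ n) f) * (\<Prod>k\<in>new_roots p n. ev f (zeta (p ^ Suc n) k))"
proof -
  have "complex_of_int (cyc_norm (p ^ Suc n) f) = (\<Prod>k<p ^ Suc n. ev f (zeta (p ^ Suc n) k))"
    using assms by (intro cyc_norm_eq_prod) simp
  also have "\<dots> = (\<Prod>k\<in>{..<p ^ Suc n} - new_roots p n. ev f (zeta (p ^ Suc n) k)) *
      (\<Prod>k\<in>new_roots p n. ev f (zeta (p ^ Suc n) k))"
    by (rule prod.subset_diff) (auto simp: new_roots_def)
  also have "(\<Prod>k\<in>{..<p ^ Suc n} - new_roots p n. ev f (zeta (p ^ Suc n) k)) =
      (\<Prod>k<p ^ n. ev f (zeta (p ^ Suc n) (p * k)))"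
    by (rule prod.reindex_bij_betw[OF old_roots[OF assms], symmetric])
  also have "\<dots> = (\<Prod>k<p ^ n. ev f (zeta (p ^ n) k))"
    using assms by (simp add: zeta_def mult.assoc)
  also have "\<dots> = of_int (cyc_norm (p ^ n) f)"
    using assms by (simp add: cyc_norm_eq_prod)
  finally show ?thesis .
qed

lemma card_new_roots:
  assumes "p > 0"
  shows "card (new_roots p n) = p ^ n * (p - 1)"
proof -
  have "card ({..<p ^ Suc n} - new_roots p n) = p ^ n"
    using bij_betw_same_card[OF old_roots[OF assms]] by simp
  moreover have "card ({..<p ^ Suc n} - new_roots p n) = p ^ Suc n - card (new_roots p n)"
    by (subst card_Diff_subset) (auto simp: new_roots_def)
  moreover have "card (new_roots p n) \<le> card {..<p ^ Suc n}"
    by (intro card_mono) (auto simp: new_roots_def)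
  ultimately have "card (new_roots p n) = p * p ^ n - p ^ n" by simp
  then show ?thesis by (simp add: diff_mult_distrib2 mult.commute)
qed

text \<open>
  At a root of unity of exact order \<open>p^(n+1)\<close>, \<open>p * w = (x - 1)^\<phi>\<close> with \<open>\<phi> > d\<close>, so \<open>w * f\<close>
  equals \<open>(x - 1)^d\<close> times a polynomial \<open>F\<close> with \<open>F(1) = w(1) = -1\<close>. The \<open>\<phi>\<close>-th power of this
  relation replaces the remaining power of \<open>x - 1\<close> by \<open>p^d * w^d\<close>. Taking the product over the
  \<open>\<phi>\<close> new roots compares valuations, in which \<open>w\<close> and \<open>F\<close> play the role of units.
\<close>
lemma multiplicity_cyc_norm_Suc:
  assumes p: "prime p" and f: "f = xm1 ^ d + of_nat p * h" and d: "d < p ^ n * (p - 1)"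
    and nz: "cyc_norm (p ^ n) f \<noteq> 0" "cyc_norm (p ^ Suc n) f \<noteq> 0"
  shows "multiplicity (int p) (cyc_norm (p ^ Suc n) f) = multiplicity (int p) (cyc_norm (p ^ n) f) + d"
proof -
  have p0: "p > 0" using prime_gt_0_nat[OF p] .
  define \<phi> where "\<phi> = p ^ n * (p - 1)"
  define Z where "Z = zeta (p ^ Suc n)"
  define R where "R = new_roots p n"
  obtain w where w: "xm1 ^ \<phi> = (\<Sum>k<p. monom 1 (p ^ n) ^ k) + of_nat p * w" "poly w 1 = -1"
    using xm1_power_cong_cyclotomic[OF p] unfolding \<phi>_def by blast
  define F where "F = w + xm1 ^ (\<phi> - d) * h"
  have F1: "poly F 1 = -1" using d w(2) by (simp add: F_def \<phi>_def)
  have key: "ev w (Z k) ^ \<phi> * ev f (Z k) ^ \<phi> = of_nat p ^ d * ev w (Z k) ^ d * ev F (Z k) ^ \<phi>"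
    if k: "k \<in> R" for k
  proof -
    define z where "z = Z k"
    have q: "p ^ Suc n > 0" using p0 by simp
    have zp: "z ^ p ^ n = zeta p k"
      using p0 by (simp add: z_def Z_def zeta_def Complex.DeMoivre)
    have "zeta p k \<noteq> 1" "zeta p k ^ p = 1"
      using k zeta_eq_1_iff[OF p0] zeta_pow[OF p0] by (auto simp: R_def new_roots_def)
    then have "(\<Sum>k<p. (z ^ p ^ n) ^ k) = 0" unfolding zp by (simp add: geometric_sum)
    then have w_z: "(z - 1) ^ \<phi> = of_nat p * ev w z"
      using arg_cong[OF w(1), of "\<lambda>g. ev g z"] by (simp add: ev_monom algebra_simps)
    have "ev w z * ev f z = (z - 1) ^ d * ev w z + (z - 1) ^ \<phi> * ev h z"
      unfolding w_z f by (simp add: algebra_simps)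
    also have "(z - 1) ^ \<phi> = (z - 1) ^ d * (z - 1) ^ (\<phi> - d)"
      using d by (simp add: \<phi>_def flip: power_add)
    finally have "ev w z * ev f z = (z - 1) ^ d * ev F z"
      by (simp add: F_def algebra_simps)
    then have "(ev w z * ev f z) ^ \<phi> = ((z - 1) ^ \<phi>) ^ d * ev F z ^ \<phi>"
      by (simp add: power_mult_distrib mult.commute flip: power_mult)
    then show ?thesis unfolding w_z by (simp add: power_mult_distrib z_def)
  qed
  define a b where "a g = cyc_norm (p ^ n) g" and "b g = cyc_norm (p ^ Suc n) g" for g
  define N where "N g = (\<Prod>k\<in>R. ev g (Z k))" for g
  have bN: "of_int (b g) = of_int (a g) * N g" for g
    unfolding a_def b_def N_def R_def Z_def by (rule cyc_norm_Suc[OF p0])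
  have N: "N w ^ \<phi> * N f ^ \<phi> = of_nat p ^ (d * \<phi>) * N w ^ d * N F ^ \<phi>"
  proof -
    have "N w ^ \<phi> * N f ^ \<phi> = (\<Prod>k\<in>R. ev w (Z k) ^ \<phi> * ev f (Z k) ^ \<phi>)"
      by (simp add: N_def prod.distrib prod_power_distrib)
    also have "\<dots> = (\<Prod>k\<in>R. of_nat p ^ d * ev w (Z k) ^ d * ev F (Z k) ^ \<phi>)"
      using key by (intro prod.cong) auto
    also have "\<dots> = (of_nat p ^ d) ^ card R * N w ^ d * N F ^ \<phi>"
      by (simp add: N_def prod.distrib prod_power_distrib)
    also have "card R = \<phi>" by (simp add: R_def \<phi>_def card_new_roots[OF p0])
    finally show ?thesis by (simp add: power_mult)
  qed
  \<comment> \<open>products over the new roots are quotients of consecutive norms; clearing denominators leaves an equation of integers\<close>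
  have "complex_of_int (b w ^ \<phi> * a w ^ d * (b f ^ \<phi> * a F ^ \<phi>)) =
      of_int (int p ^ (d * \<phi>) * (b w ^ d * a w ^ \<phi>) * (b F ^ \<phi> * a f ^ \<phi>))"
    using N by (simp add: bN power_mult_distrib algebra_simps)
  then have eq: "b w ^ \<phi> * a w ^ d * (b f ^ \<phi> * a F ^ \<phi>) =
      int p ^ (d * \<phi>) * (b w ^ d * a w ^ \<phi>) * (b F ^ \<phi> * a f ^ \<phi>)"
    by (simp only: of_int_eq_iff)
  have unit: "\<not> int p dvd a g" "\<not> int p dvd b g" if "poly g 1 = -1" for g
    using cyc_norm_not_dvd[OF p, of g n] cyc_norm_not_dvd[OF p, of g "Suc n"] that prime_gt_1_nat[OF p]
    by (simp_all add: a_def b_def)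
  have pe: "prime_elem (int p)" using p by simp
  have units: "\<not> int p dvd a w" "\<not> int p dvd b w" "\<not> int p dvd a F" "\<not> int p dvd b F"
    using unit[OF w(2)] unit[OF F1] by auto
  have nzs: "a w \<noteq> 0" "b w \<noteq> 0" "a F \<noteq> 0" "b F \<noteq> 0" "a f \<noteq> 0" "b f \<noteq> 0"
    using units nz by (auto simp: a_def b_def)
  note [simp] = prime_elem_multiplicity_mult_distrib[OF pe] prime_elem_multiplicity_power_distrib[OF pe]
    not_dvd_imp_multiplicity_0
  have "\<phi> * multiplicity (int p) (b f) = d * \<phi> + \<phi> * multiplicity (int p) (a f)"
    using arg_cong[OF eq, of "multiplicity (int p)"] units nzs prime_gt_1_nat[OF p]
    by (simp add: multiplicity_same_power'[of "int p"] prime_elem_not_unit[OF pe])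
  then have "\<phi> * multiplicity (int p) (b f) = \<phi> * (multiplicity (int p) (a f) + d)"
    by (simp add: algebra_simps)
  moreover have "\<phi> > 0" using d unfolding \<phi>_def by linarith
  ultimately show ?thesis by (simp add: a_def b_def)
qed


section \<open>Loops and powers of x - 1\<close>

text \<open>
  A loop with voltage \<open>j\<close> contributes \<open>2 - x^j - x^(-j)\<close> to the Laplacian; the factor \<open>x^r\<close> makes
  this a polynomial for \<open>j \<le> r\<close>.
\<close>
definition loop_poly :: "nat \<Rightarrow> nat \<Rightarrow> int poly" where
  "loop_poly r j = 2 * monom 1 r - monom 1 (r + j) - monom 1 (r - j)"

text \<open>
  The coefficients of \<open>(x - 1)^(2r)\<close> are symmetric about the middle one, which is determined by the
  others because the value at 1 is 0.
\<close>
lemma xm1_power_as_loops: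
  assumes "r > 0"
  shows "xm1 ^ (2 * r) = (\<Sum>j = 1..r. [:- ((-1) ^ (r + j) * int (2 * r choose (r + j))):] * loop_poly r j)"
proof -
  define c where "c i = (-1) ^ i * int (2 * r choose i)" for i
  define U L where "U = (\<lambda>j. r + j) ` {1..r}" and "L = (\<lambda>j. r - j) ` {1..r}"
  have xm: "xm1 = monom 1 1 + [:-1:]" by (simp add: monom_altdef)
  have summand: "of_nat (2 * r choose i) * monom 1 1 ^ i * [:-1:] ^ (2 * r - i) = [:c i:] * monom 1 i"
    if "i \<le> 2 * r" for i
  proof -
    have "(-1 :: int) ^ (2 * r - i) = (-1) ^ i" using that by (simp add: minus_one_power_iff)
    then show ?thesis
      by (simp add: c_def poly_const_pow of_nat_poly monom_power smult_monom mult.commute)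
  qed
  have "xm1 ^ (2 * r) = (\<Sum>i\<le>2 * r. [:c i:] * monom 1 i)"
    unfolding xm binomial_ring by (intro sum.cong refl summand) simp
  also have "{..2 * r} = insert r (U \<union> L)"
  proof (intro equalityI subsetI)
    fix i assume i: "i \<in> {..2 * r}"
    consider "i = r" | "i < r" | "i > r" by linarith
    then show "i \<in> insert r (U \<union> L)"
    proof cases
      case 2
      then show ?thesis unfolding L_def by (intro insertI2 UnI2 image_eqI[of _ _ "r - i"]) auto
    next
      case 3
      then show ?thesis using i unfolding U_def by (intro insertI2 UnI1 image_eqI[of _ _ "i - r"]) auto
    qed simp
  qed (auto simp: U_def L_def)
  also have "(\<Sum>i\<in>\<dots>. [:c i:] * monom 1 i) = [:c r:] * monom 1 r +
      ((\<Sum>i\<in>U. [:c i:] * monom 1 i) + (\<Sum>i\<in>L. [:c i:] * monom 1 i))"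
  proof -
    have fin: "finite U" "finite L" by (simp_all add: U_def L_def)
    have "(\<Sum>i\<in>U \<union> L. [:c i:] * monom 1 i) = (\<Sum>i\<in>U. [:c i:] * monom 1 i) + (\<Sum>i\<in>L. [:c i:] * monom 1 i)"
      by (rule sum.union_disjoint[OF fin]) (auto simp: U_def L_def)
    moreover have "r \<notin> U \<union> L" by (auto simp: U_def L_def)
    ultimately show ?thesis using fin by (subst sum.insert) auto
  qed
  also have "(\<Sum>i\<in>U. [:c i:] * monom 1 i) = (\<Sum>j = 1..r. [:c (r + j):] * monom 1 (r + j))"
    unfolding U_def by (subst sum.reindex) (auto simp: inj_on_def)
  also have "(\<Sum>i\<in>L. [:c i:] * monom 1 i) = (\<Sum>j = 1..r. [:c (r - j):] * monom 1 (r - j))"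
    unfolding L_def by (subst sum.reindex) (auto simp: inj_on_def)
  also have "(\<Sum>j = 1..r. [:c (r - j):] * monom 1 (r - j)) = (\<Sum>j = 1..r. [:c (r + j):] * monom 1 (r - j))"
  proof (intro sum.cong refl)
    fix j assume j: "j \<in> {1..r}"
    have "2 * r choose (r - j) = 2 * r choose (r + j)"
      using j by (subst binomial_symmetric) (auto simp: mult_2)
    moreover have "(-1 :: int) ^ (r - j) = (-1) ^ (r + j)" using j by (simp add: minus_one_power_iff)
    ultimately show "[:c (r - j):] * monom 1 (r - j) = [:c (r + j):] * monom 1 (r - j)"
      by (simp add: c_def)
  qed
  finally have expand: "xm1 ^ (2 * r) = [:c r:] * monom 1 r +
      (\<Sum>j = 1..r. [:c (r + j):] * (monom 1 (r + j) + monom 1 (r - j)))"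
    by (simp only: sum.distrib distrib_left)
  have "0 = poly (xm1 ^ (2 * r)) 1" using assms by simp
  also have "\<dots> = c r + (\<Sum>j = 1..r. c (r + j) * 2)"
    unfolding expand by (simp add: poly_sum poly_monom)
  finally have "c r = (\<Sum>j = 1..r. - (c (r + j) * 2))" by (simp add: sum_negf)
  moreover have "(\<Sum>a\<in>A. [:g a:]) = [:sum g A:]" for g :: "nat \<Rightarrow> int" and A
    by (induction A rule: infinite_finite_induct) simp_all
  ultimately have "[:c r:] = (\<Sum>j = 1..r. - [:c (r + j):] * 2)"
    by (simp only: mult_minus_left) (simp add: numeral_poly mult.commute)
  then have "xm1 ^ (2 * r) = (\<Sum>j = 1..r. - [:c (r + j):] * 2 * monom 1 r +
      [:c (r + j):] * (monom 1 (r + j) + monom 1 (r - j)))"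
    unfolding expand by (simp only: sum_distrib_right sum.distrib)
  also have "\<dots> = (\<Sum>j = 1..r. [:- c (r + j):] * loop_poly r j)"
    by (intro sum.cong refl) (simp add: loop_poly_def algebra_simps)
  finally show ?thesis by (simp only: c_def)
qed

text \<open>
  The numbers of loops must not be negative, but only their residues modulo \<open>p\<close> matter. Also the
  number \<open>K\<close> of edges to the ramified vertex must be positive for connectedness, hence the choice
  \<open>K = p\<close>; for \<open>r = 0\<close> there are no loops, and \<open>K = 1\<close> is the constant polynomial itself.
\<close>
lemma loop_combination_exists:
  assumes "p > 0"
  obtains K :: nat and d :: "nat \<Rightarrow> nat" and h where "K > 0"
    and "of_nat K * monom 1 r + (\<Sum>j = 1..r. of_nat (d j) * loop_poly r j) = xm1 ^ (2 * r) + of_nat p * h"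
proof (cases "r = 0")
  case True
  then have "of_nat 1 * monom 1 r + (\<Sum>j = 1..r. of_nat 0 * loop_poly r j) = xm1 ^ (2 * r) + of_nat p * 0"
    by (simp add: monom_0 one_pCons)
  then show ?thesis using that[of 1 "\<lambda>_. 0" 0] by simp
next
  case False
  define c where "c j = - ((-1) ^ (r + j) * int (2 * r choose (r + j)))" for j
  define d where "d j = nat (c j mod int p)" for j
  have "int (d j) = c j - int p * (c j div int p)" for j
    using assms by (simp add: d_def minus_mult_div_eq_mod)
  then have d: "of_nat (d j) = [:c j:] - of_nat p * [:c j div int p:]" for j
    by (simp add: of_nat_poly)
  define h where "h = monom 1 r - (\<Sum>j = 1..r. [:c j div int p:] * loop_poly r j)"
  have "xm1 ^ (2 * r) = (\<Sum>j = 1..r. [:c j:] * loop_poly r j)"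
    unfolding c_def using False by (intro xm1_power_as_loops) simp
  then have "of_nat p * monom 1 r + (\<Sum>j = 1..r. of_nat (d j) * loop_poly r j) = xm1 ^ (2 * r) + of_nat p * h"
    unfolding d h_def
    by (simp only: left_diff_distrib sum_subtractf sum_distrib_left right_diff_distrib mult.assoc)
  then show ?thesis using that assms by blast
qed

lemma zeta_loop:
  "zeta q k ^ r * (2 - zeta q k powi int j - zeta q k powi (- int j)) = ev (loop_poly r j) (zeta q k)"
  if "j \<le> r"
proof -
  have "zeta q k ^ r = zeta q k ^ (r - j) * zeta q k ^ j" using that by (simp flip: power_add)
  then have "zeta q k ^ r * zeta q k powi (- int j) = zeta q k ^ (r - j)"
    by (simp add: power_int_minus field_simps)
  moreover have "ev 2 z = 2" for z using ev_of_nat[of 2 z] by simp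
  ultimately show ?thesis by (simp add: loop_poly_def ev_monom power_add algebra_simps)
qed

text \<open>
  The number of spanning trees in the layer with group of order \<open>q\<close>, for \<open>K\<close> edges to the ramified
  vertex and loops with the listed voltages.
\<close>
definition loop_norm :: "nat \<Rightarrow> nat \<Rightarrow> nat list \<Rightarrow> complex" where
  "loop_norm q K js =
     (\<Prod>k<q. of_nat K + (\<Sum>j\<leftarrow>js. 2 - zeta q k powi int j - zeta q k powi (- int j)))"

lemma two_minus_zeta: "2 - zeta q k powi a - zeta q k powi (- a) = 
    of_real (2 - 2 * cos (2 * pi * real k * of_int a / real q))"
  by (simp add: zeta_powi complex_eq_iff)

text \<open>
  Each factor is real and at least \<open>K\<close>, because \<open>2 - 2 cos t\<close> is never negative.
\<close>
lemma loop_norm_nonzero: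
  assumes "K > 0"
  shows "loop_norm q K js \<noteq> 0"
proof -
  have "of_nat K + (\<Sum>j\<leftarrow>js. 2 - zeta q k powi int j - zeta q k powi (- int j)) \<noteq> 0" for k
  proof -
    define x where "x = (\<Sum>j\<leftarrow>js. 2 - 2 * cos (2 * pi * real k * of_int (int j) / real q))"
    have "x \<ge> 0" unfolding x_def by (intro sum_list_nonneg) (auto)
    then have "real K + x \<noteq> 0" using assms by linarith
    moreover have "(\<Sum>j\<leftarrow>js. complex_of_real (2 - 2 * cos (2 * pi * real k * of_int (int j) / real q))) = of_real x"
      unfolding x_def by (induction js) simp_all
    ultimately have "of_nat K + (\<Sum>j\<leftarrow>js. 2 - zeta q k powi int j - zeta q k powi (- int j)) =
        complex_of_real (real K + x)"
      unfolding two_minus_zeta by simp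
    with \<open>real K + x \<noteq> 0\<close> show ?thesis by (simp only: of_real_eq_0_iff) simp
  qed
  then show ?thesis by (simp add: loop_norm_def)
qed

text \<open>
  Repeating every edge \<open>p^m\<close> times multiplies each of the \<open>p^n\<close> factors of the norm by \<open>p^m\<close>,
  which accounts for the term \<open>m * p^n\<close>. The remaining polynomial is congruent to
  \<open>(x - 1)^(2r)\<close> modulo \<open>p\<close>, so from some layer on its norm gains the valuation \<open>2r\<close> in each step.
\<close>
lemma loops_with_invariants:
  fixes p r m :: nat
  assumes p: "prime p"
  obtains K js N c where "K > 0"
    and "\<And>n \<kappa> :: nat. n \<ge> N \<Longrightarrow> of_nat \<kappa> = loop_norm (p ^ n) K js \<Longrightarrow>
           int (multiplicity p \<kappa>) = int (2 * r) * int n + int m * int p ^ n + c"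
proof -
  have p0: "p > 0" using prime_gt_0_nat[OF p] .
  have pe: "prime_elem (int p)" using p by simp
  obtain K d h where K: "K > 0" and
    f: "of_nat K * monom 1 r + (\<Sum>j = 1..r. of_nat (d j) * loop_poly r j) = xm1 ^ (2 * r) + of_nat p * h"
    using loop_combination_exists[OF p0] .
  define f where "f = xm1 ^ (2 * r) + of_nat p * h"
  define js where "js = concat (map (\<lambda>j. replicate (p ^ m * d j) j) [1..<Suc r])"
  have js: "(\<Sum>j\<leftarrow>js. g j) = of_nat (p ^ m) * (\<Sum>j = 1..r. of_nat (d j) * g j)" for g :: "nat \<Rightarrow> complex"
  proof -
    have "(\<Sum>j\<leftarrow>concat (map (\<lambda>j. replicate (e j) j) ks). g j) = (\<Sum>j\<leftarrow>ks. of_nat (e j) * g j)"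
      for e :: "nat \<Rightarrow> nat" and ks
      by (induction "ks") (simp_all add: sum_list_replicate)
    then have "(\<Sum>j\<leftarrow>js. g j) = (\<Sum>j\<leftarrow>[1..<Suc r]. of_nat (p ^ m * d j) * g j)"
      unfolding js_def .
    also have "\<dots> = (\<Sum>j = 1..r. of_nat (p ^ m * d j) * g j)"
      by (simp only: interv_sum_list_conv_sum_set_nat set_upt atLeastLessThanSuc_atLeastAtMost)
    finally show ?thesis by (simp add: sum_distrib_left mult.assoc)
  qed
  have zf: "zeta q k ^ r * (of_nat (p ^ m * K) + (\<Sum>j\<leftarrow>js. 2 - zeta q k powi int j - zeta q k powi (- int j)))
      = of_nat (p ^ m) * ev f (zeta q k)" for q k
  proof -
    have "ev f (zeta q k) = of_nat K * zeta q k ^ r + (\<Sum>j = 1..r. of_nat (d j) * ev (loop_poly r j) (zeta q k))"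
      unfolding f_def f[symmetric] by (simp add: ev_monom)
    also have "(\<Sum>j = 1..r. of_nat (d j) * ev (loop_poly r j) (zeta q k)) =
        (\<Sum>j = 1..r. of_nat (d j) * (zeta q k ^ r * (2 - zeta q k powi int j - zeta q k powi (- int j))))"
      by (intro sum.cong refl) (subst zeta_loop; simp)
    also have "\<dots> = zeta q k ^ r * (\<Sum>j = 1..r. of_nat (d j) * (2 - zeta q k powi int j - zeta q k powi (- int j)))"
      by (simp add: sum_distrib_left mult_ac)
    finally show ?thesis unfolding js by (simp only: of_nat_mult) (simp add: algebra_simps)
  qed
  \<comment> \<open>the factors \<open>x^r\<close> have absolute value 1 at roots of unity\<close>
  have norms: "norm (loop_norm (p ^ n) (p ^ m * K) js) = real_of_int (\<bar>int p ^ (m * p ^ n) * cyc_norm (p ^ n) f\<bar>)" for n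
  proof -
    define q where "q = p ^ n"
    have q: "q > 0" using p0 by (simp add: q_def)
    have nz: "norm (zeta q k) = 1" for k by (simp add: zeta_def)
    have "norm (loop_norm q (p ^ m * K) js) = (\<Prod>k<q. norm (zeta q k ^ r *
        (of_nat (p ^ m * K) + (\<Sum>j\<leftarrow>js. 2 - zeta q k powi int j - zeta q k powi (- int j)))))"
      by (simp only: loop_norm_def prod_norm[symmetric] norm_mult norm_power nz power_one mult_1_left)
    also have "\<dots> = (\<Prod>k<q. norm (of_nat (p ^ m) * ev f (zeta q k)))"
      by (simp only: zf)
    also have "\<dots> = norm (of_nat (p ^ m) ^ q * complex_of_int (cyc_norm q f))"
      by (simp add: cyc_norm_eq_prod[OF q] norm_mult norm_power prod.distrib prod_norm)
    also have "\<dots> = real_of_int (\<bar>int p ^ (m * q) * cyc_norm q f\<bar>)"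
      by (simp add: norm_mult norm_power power_mult abs_mult)
    finally show ?thesis by (simp add: q_def)
  qed
  have nz: "cyc_norm (p ^ n) f \<noteq> 0" for n
    using norms[of n] loop_norm_nonzero[of "p ^ m * K" "p ^ n" js] K p0 by auto
  define V where "V n = multiplicity (int p) (cyc_norm (p ^ n) f)" for n
  have step: "V (Suc n) = V n + 2 * r" if n: "n \<ge> 2 * r" for n
  proof -
    have "2 * r < p ^ n" using n less_exp[of n] power_mono[of 2 p n] prime_ge_2_nat[OF p] by linarith
    also have "\<dots> \<le> p ^ n * (p - 1)" using prime_gt_1_nat[OF p] by simp
    finally show ?thesis
      unfolding V_def by (intro multiplicity_cyc_norm_Suc[OF p f_def] nz)
  qed
  have V: "V (2 * r + i) = V (2 * r) + 2 * r * i" for i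
    by (induction i) (simp_all add: step)
  show ?thesis
  proof (rule that[of "p ^ m * K" "2 * r" js "int (V (2 * r)) - int (2 * r * (2 * r))"])
    show "p ^ m * K > 0" using K p0 by simp
    fix n \<kappa> :: nat
    assume n: "n \<ge> 2 * r" and \<kappa>: "of_nat \<kappa> = loop_norm (p ^ n) (p ^ m * K) js"
    have "real \<kappa> = real_of_int \<bar>int p ^ (m * p ^ n) * cyc_norm (p ^ n) f\<bar>"
      using norms[of n] unfolding \<kappa>[symmetric] by simp
    then have "int \<kappa> = \<bar>int p ^ (m * p ^ n) * cyc_norm (p ^ n) f\<bar>" by linarith
    then have "multiplicity (int p) (int \<kappa>) = multiplicity (int p) (int p ^ (m * p ^ n) * cyc_norm (p ^ n) f)"
      by (metis multiplicity_normalize_right normalize_int_def)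
    also have "\<dots> = m * p ^ n + V n"
      using nz[of n] p0 prime_gt_1_nat[OF p] unfolding V_def
      by (subst prime_elem_multiplicity_mult_distrib[OF pe]) (auto simp: multiplicity_same_power')
    also have "multiplicity (int p) (int \<kappa>) = multiplicity p \<kappa>"
    proof -
      have "int p ^ k dvd int \<kappa> \<longleftrightarrow> p ^ k dvd \<kappa>" for k by (metis int_dvd_int_iff of_nat_power)
      then show ?thesis by (simp add: multiplicity_def)
    qed
    finally have mult: "multiplicity p \<kappa> = m * p ^ n + V n" .
    obtain i where i: "n = 2 * r + i" using n le_Suc_ex by blast
    have "V n = V (2 * r) + 2 * r * i" using V[of i] by (simp add: i)
    then show "int (multiplicity p \<kappa>) = int (2 * r) * int n + int m * int p ^ n +
        (int (V (2 * r)) - int (2 * r * (2 * r)))"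
      unfolding mult by (simp add: i algebra_simps)
  qed
qed


section \<open>The layers of the p-adic integers\<close>

lemma Zp_mem:
  "x \<in> carrier (Zp p) \<longleftrightarrow> (\<forall>n. x n \<in> {0..<int p ^ n} \<and> x (Suc n) mod int p ^ n = x n)"
  by (simp add: Zp_def)

lemma Zp_mult [simp]: "x \<otimes>\<^bsub>Zp p\<^esub> y = (\<lambda>n. (x n + y n) mod int p ^ n)"
  by (simp add: Zp_def)

lemma Zp_one [simp]: "\<one>\<^bsub>Zp p\<^esub> = (\<lambda>_. 0)"
  by (simp add: Zp_def)

lemma Zp_mod:
  assumes "x \<in> carrier (Zp p)"
  shows "x (m + k) mod int p ^ m = x m"
proof (induction k)
  case 0
  then show ?case using assms by (auto simp: Zp_mem)
next
  case (Suc k)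
  have "x (m + Suc k) mod int p ^ m = x (Suc (m + k)) mod int p ^ (m + k) mod int p ^ m"
    by (simp add: mod_mod_cancel le_imp_power_dvd)
  then show ?case using Suc assms by (simp add: Zp_mem)
qed

lemma Zp_of_residues:
  assumes "p > 0" and "\<And>n. f (Suc n) mod int p ^ n = f n mod int p ^ n"
  shows "(\<lambda>n. f n mod int p ^ n) \<in> carrier (Zp p)"
  using assms by (simp add: Zp_mem mod_mod_cancel)

lemma Zp_residue: "p > 0 \<Longrightarrow> (\<lambda>n. a mod int p ^ n) \<in> carrier (Zp p)"
  by (rule Zp_of_residues) simp_all

lemma Zp_comm_group:
  assumes "p > 0"
  shows "comm_group (Zp p)"
proof (rule comm_groupI)
  fix x y z assume x: "x \<in> carrier (Zp p)" and y: "y \<in> carrier (Zp p)" and z: "z \<in> carrier (Zp p)"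
  show "x \<otimes>\<^bsub>Zp p\<^esub> y \<in> carrier (Zp p)"
    unfolding Zp_mult using x y by (intro Zp_of_residues[OF assms]) (metis Zp_mem mod_add_eq mod_mod_trivial)
  show "x \<otimes>\<^bsub>Zp p\<^esub> y \<otimes>\<^bsub>Zp p\<^esub> z = x \<otimes>\<^bsub>Zp p\<^esub> (y \<otimes>\<^bsub>Zp p\<^esub> z)"
    by (simp add: mod_simps add.assoc)
  show "x \<otimes>\<^bsub>Zp p\<^esub> y = y \<otimes>\<^bsub>Zp p\<^esub> x" by (simp add: add.commute)
  show "\<one>\<^bsub>Zp p\<^esub> \<otimes>\<^bsub>Zp p\<^esub> x = x" using x by (auto simp: Zp_mem)
  have "(\<lambda>n. - x n mod int p ^ n) \<in> carrier (Zp p)"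
    using x by (intro Zp_of_residues[OF assms]) (metis Zp_mem mod_minus_eq)
  moreover have "(\<lambda>n. - x n mod int p ^ n) \<otimes>\<^bsub>Zp p\<^esub> x = \<one>\<^bsub>Zp p\<^esub>" by (simp add: mod_simps)
  ultimately show "\<exists>y\<in>carrier (Zp p). y \<otimes>\<^bsub>Zp p\<^esub> x = \<one>\<^bsub>Zp p\<^esub>" by blast
next
  show "\<one>\<^bsub>Zp p\<^esub> \<in> carrier (Zp p)" using assms by (simp add: Zp_mem)
qed

lemma Zp_inv:
  assumes "p > 0" "x \<in> carrier (Zp p)"
  shows "inv\<^bsub>Zp p\<^esub> x = (\<lambda>n. - x n mod int p ^ n)"
proof (rule group.inv_equality)
  show "group (Zp p)" using Zp_comm_group[OF assms(1)] by (rule comm_group.axioms)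
  show "(\<lambda>n. - x n mod int p ^ n) \<otimes>\<^bsub>Zp p\<^esub> x = \<one>\<^bsub>Zp p\<^esub>" by (simp add: mod_simps)
  show "(\<lambda>n. - x n mod int p ^ n) \<in> carrier (Zp p)"
    using assms by (intro Zp_of_residues) (auto, metis Zp_mem mod_minus_eq)
qed (rule assms)

lemma Zp_pow:
  assumes "x \<in> carrier (Zp p)"
  shows "x [^]\<^bsub>Zp p\<^esub> (k :: nat) = (\<lambda>n. (int k * x n) mod int p ^ n)"
  by (induction k) (simp_all add: nat_pow_def fun_eq_iff mod_simps algebra_simps del: Zp_mult, simp_all add: mod_simps algebra_simps)

text \<open>
  A compatible sequence whose first \<open>n\<close> digits vanish is divided by \<open>p^n\<close> by shifting it \<open>n\<close> places.
\<close>
lemma power_subgroup_Zp: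
  assumes "p > 0"
  shows "power_subgroup (Zp p) (p ^ n) = {x \<in> carrier (Zp p). x n = 0}"
proof (intro equalityI subsetI)
  fix y assume "y \<in> power_subgroup (Zp p) (p ^ n)"
  then obtain x where x: "x \<in> carrier (Zp p)" "y = x [^]\<^bsub>Zp p\<^esub> (p ^ n)"
    by (auto simp: power_subgroup_def)
  interpret comm_group "Zp p" by (rule Zp_comm_group[OF assms])
  show "y \<in> {x \<in> carrier (Zp p). x n = 0}"
    using x Zp_pow[OF x(1), of "p ^ n"] nat_pow_closed[OF x(1), of "p ^ n"] by simp
next
  fix y assume "y \<in> {x \<in> carrier (Zp p). x n = 0}"
  then have y: "y \<in> carrier (Zp p)" "y n = 0" by auto
  define x where "x k = y (n + k) div int p ^ n" for k
  have yx: "y (n + k) = int p ^ n * x k" for k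
    using Zp_mod[OF y(1), of n k] y(2) by (simp add: x_def mod_eq_0_iff_dvd)
  have "x \<in> carrier (Zp p)"
    unfolding Zp_mem
  proof (intro allI conjI)
    fix k
    have b: "0 \<le> int p ^ n * x k" "int p ^ n * x k < int p ^ n * int p ^ k"
      unfolding yx[symmetric] power_add[symmetric] using y(1) by (simp_all add: Zp_mem)
    have pn: "int p ^ n > 0" using assms by simp
    show "x k \<in> {0..<int p ^ k}"
      using b mult_le_cancel_left_pos[OF pn, of 0 "x k"] mult_less_cancel_left_pos[OF pn] by auto
    have "int p ^ n * (x (Suc k) mod int p ^ k) = y (Suc (n + k)) mod int p ^ (n + k)"
      unfolding mult_mod_right yx[symmetric] power_add[symmetric] by simp
    also have "\<dots> = int p ^ n * x k" using y(1) yx[of k] by (simp add: Zp_mem)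
    finally show "x (Suc k) mod int p ^ k = x k" using assms by simp
  qed
  moreover have "y k = (int (p ^ n) * x k) mod int p ^ k" for k
    using Zp_mod[OF y(1), of k n] yx[of k] by (simp add: add.commute)
  ultimately show "y \<in> power_subgroup (Zp p) (p ^ n)"
    unfolding power_subgroup_def using Zp_pow by (intro image_eqI[of _ _ x]) (auto simp: fun_eq_iff)
qed

text \<open>
  The elements of the \<open>n\<close>-th layer, as sets of \<open>p\<close>-adic integers with a common residue modulo \<open>p^n\<close>.
\<close>
definition residue_class :: "nat \<Rightarrow> nat \<Rightarrow> int \<Rightarrow> (nat \<Rightarrow> int) set" where
  "residue_class p n a = {x \<in> carrier (Zp p). x n = a}"

lemma Zp_nth_bounds: "x \<in> carrier (Zp p) \<Longrightarrow> x n \<in> {0..<int (p ^ n)}"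
  by (simp add: Zp_mem)

lemma layer_proj_Zp:
  assumes p: "p > 0" and x: "x \<in> carrier (Zp p)"
  shows "layer_proj p (Zp p) n x = residue_class p n (x n)"
proof -
  interpret comm_group "Zp p" by (rule Zp_comm_group[OF p])
  have xn: "x n mod int p ^ n = x n" for n using x by (auto simp: Zp_mem)
  show ?thesis
  proof (intro equalityI subsetI)
    fix y assume "y \<in> layer_proj p (Zp p) n x"
    then obtain h where "h \<in> carrier (Zp p)" "h n = 0" "y = h \<otimes>\<^bsub>Zp p\<^esub> x"
      by (auto simp: layer_proj_def power_subgroup_Zp[OF p] r_coset_def simp del: Zp_mult)
    then show "y \<in> residue_class p n (x n)"
      using m_closed[of h x] x xn by (simp add: residue_class_def)
  next
    fix y assume "y \<in> residue_class p n (x n)"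
    then have y: "y \<in> carrier (Zp p)" "y n = x n" by (auto simp: residue_class_def)
    define h where "h = y \<otimes>\<^bsub>Zp p\<^esub> inv\<^bsub>Zp p\<^esub> x"
    have "h \<in> carrier (Zp p)" using x y by (simp add: h_def del: Zp_mult)
    moreover have "h n = 0" unfolding h_def Zp_inv[OF p x] Zp_mult y(2) by (simp add: mod_simps)
    moreover have "h \<otimes>\<^bsub>Zp p\<^esub> x = y" using x y by (simp add: h_def m_assoc del: Zp_mult Zp_one)
    ultimately show "y \<in> layer_proj p (Zp p) n x"
      unfolding layer_proj_def power_subgroup_Zp[OF p] r_coset_def by blast
  qed
qed

lemma inj_on_residue_class:
  assumes "p > 0"
  shows "inj_on (residue_class p n) {0..<int (p ^ n)}"
proof (rule inj_onI)
  fix a b assume ab: "a \<in> {0..<int (p ^ n)}" "residue_class p n a = residue_class p n b"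
  have "(\<lambda>k. a mod int p ^ k) \<in> residue_class p n a"
    using Zp_residue[OF assms, of a] ab(1) by (simp add: residue_class_def)
  then have "(\<lambda>k. a mod int p ^ k) \<in> residue_class p n b" by (simp only: ab(2))
  then have "a mod int p ^ n = b" unfolding residue_class_def by blast
  then show "a = b" using ab(1) by simp
qed

lemma carrier_layer:
  assumes "p > 0"
  shows "carrier (layer p (Zp p) n) = residue_class p n ` {0..<int (p ^ n)}"
proof -
  have "carrier (layer p (Zp p) n) = layer_proj p (Zp p) n ` carrier (Zp p)"
    by (simp add: layer_def layer_proj_def carrier_FactGroup)
  also have "\<dots> = residue_class p n ` ((\<lambda>x. x n) ` carrier (Zp p))"
    by (auto simp: layer_proj_Zp[OF assms] image_image)
  also have "(\<lambda>x. x n) ` carrier (Zp p) = {0..<int (p ^ n)}"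
  proof (intro equalityI subsetI)
    fix a assume "a \<in> {0..<int (p ^ n)}"
    then show "a \<in> (\<lambda>x. x n) ` carrier (Zp p)"
      using Zp_residue[OF assms, of a] by (intro image_eqI[of _ _ "\<lambda>k. a mod int p ^ k"]) auto
  qed (use Zp_nth_bounds in blast)
  finally show ?thesis .
qed

lemma mult_layer:
  assumes p: "p > 0" and ab: "a \<in> {0..<int (p ^ n)}" "b \<in> {0..<int (p ^ n)}"
  shows "residue_class p n a \<otimes>\<^bsub>layer p (Zp p) n\<^esub> residue_class p n b =
           residue_class p n ((a + b) mod int (p ^ n))"
proof -
  interpret comm_group "Zp p" by (rule Zp_comm_group[OF p])
  have mem: "x \<otimes>\<^bsub>Zp p\<^esub> y \<in> carrier (Zp p)" if "x \<in> carrier (Zp p)" "y \<in> carrier (Zp p)" for x y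
    using that by (rule m_closed)
  show ?thesis
  proof (intro equalityI subsetI)
    fix z assume "z \<in> residue_class p n a \<otimes>\<^bsub>layer p (Zp p) n\<^esub> residue_class p n b"
    then obtain x y where "x \<in> carrier (Zp p)" "y \<in> carrier (Zp p)" "x n = a" "y n = b" "z = x \<otimes>\<^bsub>Zp p\<^esub> y"
      by (auto simp: layer_def set_mult_def residue_class_def simp del: Zp_mult)
    then show "z \<in> residue_class p n ((a + b) mod int (p ^ n))"
      using mem[of x y] by (simp add: residue_class_def)
  next
    fix z assume "z \<in> residue_class p n ((a + b) mod int (p ^ n))"
    then have z: "z \<in> carrier (Zp p)" "z n = (a + b) mod int (p ^ n)" by (auto simp: residue_class_def)
    define x where "x = (\<lambda>k. a mod int p ^ k)"
    have x: "x \<in> carrier (Zp p)" unfolding x_def by (rule Zp_residue[OF p])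
    define y where "y = inv\<^bsub>Zp p\<^esub> x \<otimes>\<^bsub>Zp p\<^esub> z"
    have y: "y \<in> carrier (Zp p)" using x z by (simp add: y_def del: Zp_mult)
    have "y n = b"
      unfolding y_def Zp_inv[OF p x] Zp_mult z(2) using ab by (simp add: x_def mod_simps)
    moreover have "x n = a" using ab by (simp add: x_def)
    moreover have "x \<otimes>\<^bsub>Zp p\<^esub> y = z"
      unfolding y_def using x z by (simp add: m_assoc[symmetric] del: Zp_mult Zp_one)
    ultimately have "\<exists>x\<in>residue_class p n a. \<exists>y\<in>residue_class p n b. z = x \<otimes>\<^bsub>Zp p\<^esub> y"
      using x y by (auto simp: residue_class_def simp del: Zp_mult)
    then show "z \<in> residue_class p n a \<otimes>\<^bsub>layer p (Zp p) n\<^esub> residue_class p n b"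
      by (simp add: layer_def set_mult_def del: Zp_mult)
  qed
qed


section \<open>Coverings of two-vertex graphs\<close>

locale two_vertex_voltage = serre_graph X for X :: "('v, 'e) sgraph" +
  fixes p :: nat and \<alpha> :: "'e \<Rightarrow> nat \<Rightarrow> int" and v w :: 'v and I :: "'v \<Rightarrow> (nat \<Rightarrow> int) set"
  assumes p: "p > 1"
    and verts: "verts X = {v, w}" "v \<noteq> w"
    and voltage: "e \<in> edges X \<Longrightarrow> \<alpha> e \<in> carrier (Zp p)"
    and voltage_inv: "e \<in> edges X \<Longrightarrow> \<alpha> (einv X e) = inv\<^bsub>Zp p\<^esub> (\<alpha> e)"
    and I: "I v = {\<one>\<^bsub>Zp p\<^esub>}" "I w = carrier (Zp p)"
    and linked: "\<exists>e\<in>edges X. src X e = v \<and> tgt X e = w"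
begin

definition cls :: "nat \<Rightarrow> int \<Rightarrow> (nat \<Rightarrow> int) set" where
  "cls n c = residue_class p n (c mod int (p ^ n))"

abbreviation hub :: "nat \<Rightarrow> (nat \<Rightarrow> int) set set \<times> 'v" where
  "hub n \<equiv> (carrier (layer p (Zp p) n), w)"

abbreviation Y :: "nat \<Rightarrow> ((nat \<Rightarrow> int) set set \<times> 'v, (nat \<Rightarrow> int) set \<times> 'e) sgraph" where
  "Y n \<equiv> derived_graph p (Zp p) X \<alpha> I n"

text \<open>
  The vertex of the \<open>n\<close>-th layer over \<open>x\<close> with residue \<open>c\<close>. Over the totally ramified vertex \<open>w\<close> the
  residue is forgotten, and only the hub is left.
\<close>
definition vertex :: "nat \<Rightarrow> 'v \<Rightarrow> int \<Rightarrow> (nat \<Rightarrow> int) set set \<times> 'v" where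
  "vertex n x c = (if x = v then ({cls n c}, v) else hub n)"

lemma p0: "p > 0" and pn: "int (p ^ n) > 0"
  using p by simp_all

lemma cls_mult: "cls n a \<otimes>\<^bsub>layer p (Zp p) n\<^esub> cls n b = cls n (a + b)"
  unfolding cls_def using pn[of n] by (subst mult_layer[OF p0]) (simp_all add: mod_simps del: of_nat_power)

lemma cls_eq_iff: "cls n a = cls n b \<longleftrightarrow> a mod int (p ^ n) = b mod int (p ^ n)"
  unfolding cls_def using pn[of n] by (intro inj_on_eq_iff[OF inj_on_residue_class[OF p0]]) (simp_all del: of_nat_power)

lemma cls_range: "carrier (layer p (Zp p) n) = range (cls n)"
proof -
  have "range (\<lambda>c. c mod int (p ^ n)) = {0..<int (p ^ n)}"
  proof (intro equalityI subsetI)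
    fix c assume "c \<in> {0..<int (p ^ n)}"
    then show "c \<in> range (\<lambda>c. c mod int (p ^ n))"
      by (intro image_eqI[of _ _ c]) (simp_all del: of_nat_power)
  qed (use pn[of n] in \<open>auto simp del: of_nat_power\<close>)
  then show ?thesis unfolding carrier_layer[OF p0] cls_def by (metis image_image)
qed

lemma proj_voltage: "e \<in> edges X \<Longrightarrow> layer_proj p (Zp p) n (\<alpha> e) = cls n (\<alpha> e n)"
  using Zp_nth_bounds[OF voltage, of e n] by (simp add: cls_def layer_proj_Zp[OF p0 voltage])

lemma voltage_inv_nth: "e \<in> edges X \<Longrightarrow> \<alpha> (einv X e) n = - \<alpha> e n mod int (p ^ n)"
  using voltage_inv Zp_inv[OF p0 voltage] by simp

lemma coset_vertex:
  assumes "x \<in> verts X"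
  shows "(inertia p (Zp p) I n x #>\<^bsub>layer p (Zp p) n\<^esub> cls n c, x) = vertex n x c"
proof (cases "x = v")
  case True
  have "inertia p (Zp p) I n v = {layer_proj p (Zp p) n (\<lambda>_. 0)}"
    by (simp add: inertia_def I)
  also have "layer_proj p (Zp p) n (\<lambda>_. 0) = cls n 0"
    using p0 by (subst layer_proj_Zp) (simp_all add: Zp_mem cls_def)
  finally show ?thesis using True cls_mult[of n 0 c] by (simp add: vertex_def r_coset_def)
next
  case False
  then have x: "x = w" using assms verts by auto
  have "inertia p (Zp p) I n w = carrier (layer p (Zp p) n)"
    by (simp add: inertia_def I layer_def layer_proj_def carrier_FactGroup)
  moreover have "carrier (layer p (Zp p) n) #>\<^bsub>layer p (Zp p) n\<^esub> cls n c = carrier (layer p (Zp p) n)"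
  proof -
    have "carrier (layer p (Zp p) n) #>\<^bsub>layer p (Zp p) n\<^esub> cls n c = range (\<lambda>a. cls n (a + c))"
      unfolding cls_range by (auto simp: r_coset_def cls_mult)
    also have "\<dots> = range (cls n)"
    proof (intro equalityI subsetI)
      fix y assume "y \<in> range (cls n)"
      then obtain a where "y = cls n a" by blast
      then show "y \<in> range (\<lambda>a. cls n (a + c))" by (intro image_eqI[of _ _ "a - c"]) simp_all
    qed blast
    finally show ?thesis unfolding cls_range .
  qed
  ultimately show ?thesis using x verts(2) by (simp add: vertex_def)
qed

lemma Y_verts: "verts (Y n) = insert (hub n) (range (vertex n v))"
proof -
  have "verts (Y n) = (\<Union>x\<in>verts X. range (vertex n x))"
    by (auto simp: derived_graph_def Let_def carrier_FactGroup cls_range coset_vertex[symmetric])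
  moreover have "range (vertex n w) = {hub n}" using verts by (auto simp: vertex_def)
  ultimately show ?thesis using verts by auto
qed

lemma Y_edges: "edges (Y n) = range (cls n) \<times> edges X"
  by (simp add: derived_graph_def Let_def cls_range)

lemma Y_einv: "e \<in> edges X \<Longrightarrow> einv (Y n) (cls n c, e) = (cls n (c + \<alpha> e n), einv X e)"
  by (simp add: derived_graph_def Let_def proj_voltage cls_mult)

lemma Y_src: "e \<in> edges X \<Longrightarrow> src (Y n) (cls n c, e) = vertex n (src X e) c"
  by (simp add: derived_graph_def Let_def coset_vertex src_in)

lemma Y_tgt: "e \<in> edges X \<Longrightarrow> tgt (Y n) (cls n c, e) = vertex n (tgt X e) (c + \<alpha> e n)"
  by (simp add: derived_graph_def Let_def proj_voltage cls_mult coset_vertex tgt_in)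

lemma vertex_cong: "cls n a = cls n b \<Longrightarrow> vertex n x a = vertex n x b"
  by (simp add: vertex_def)

lemma cls_return: "e \<in> edges X \<Longrightarrow> cls n (c + \<alpha> e n + \<alpha> (einv X e) n) = cls n c"
  unfolding cls_eq_iff by (simp add: voltage_inv_nth mod_simps)

lemma vertex_in_Y: "x \<in> verts X \<Longrightarrow> vertex n x c \<in> verts (Y n)"
  unfolding Y_verts using verts by (auto simp: vertex_def)

lemma serre_graph_Y: "serre_graph (Y n)"
proof
  have "finite (range (cls n))" unfolding cls_range[symmetric] carrier_layer[OF p0] by simp
  moreover have "range (vertex n v) = (\<lambda>c. ({c}, v)) ` range (cls n)" by (auto simp: vertex_def)
  ultimately show "finite (verts (Y n))" "finite (edges (Y n))"
    by (simp_all add: Y_verts Y_edges finite_edges)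
  fix E assume "E \<in> edges (Y n)"
  then obtain c e where E: "E = (cls n c, e)" and e: "e \<in> edges X" by (auto simp: Y_edges)
  note e' = einv_in[OF e]
  show "einv (Y n) E \<in> edges (Y n)" by (simp add: E Y_einv e e' Y_edges)
  show "einv (Y n) (einv (Y n) E) = E" by (simp add: E Y_einv e e' einv_einv cls_return)
  show "einv (Y n) E \<noteq> E" by (simp add: E Y_einv e einv_neq)
  show "src (Y n) E \<in> verts (Y n)" by (simp add: E Y_src e vertex_in_Y src_in)
  show "tgt (Y n) E \<in> verts (Y n)" by (simp add: E Y_tgt e vertex_in_Y tgt_in)
  show "src (Y n) (einv (Y n) E) = tgt (Y n) E"
    by (simp add: E Y_einv Y_src Y_tgt e e' src_einv)
  show "tgt (Y n) (einv (Y n) E) = src (Y n) E"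
    by (simp add: E Y_einv Y_src Y_tgt e e' tgt_einv vertex_cong[OF cls_return])
qed

lemma connected_Y: "connected_graph (Y n)"
proof -
  interpret Y: serre_graph "Y n" by (rule serre_graph_Y)
  obtain e where e: "e \<in> edges X" "src X e = v" "tgt X e = w" using linked by blast
  define R where "R = {(src (Y n) e, tgt (Y n) e) | e. e \<in> edges (Y n)}"
  have step: "(src (Y n) E, tgt (Y n) E) \<in> R" if "E \<in> edges (Y n)" for E
    using that unfolding R_def by blast
  have "(u, hub n) \<in> R\<^sup>* \<and> (hub n, u) \<in> R\<^sup>*" if "u \<in> verts (Y n)" for u
  proof (cases "u = hub n")
    case False
    then obtain c where c: "u = vertex n v c" using \<open>u \<in> _\<close> by (auto simp: Y_verts)
    define E where "E = (cls n c, e)"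
    have E: "E \<in> edges (Y n)" using e by (simp add: E_def Y_edges)
    have ends: "src (Y n) E = u" "tgt (Y n) E = hub n"
      using e verts by (simp_all add: E_def Y_src Y_tgt c vertex_def)
    have "(u, hub n) \<in> R" using step[OF E] by (simp only: ends)
    moreover have "(hub n, u) \<in> R"
      using step[OF Y.einv_in[OF E]] by (simp only: Y.src_einv[OF E] Y.tgt_einv[OF E] ends)
    ultimately show ?thesis by (simp add: r_into_rtrancl)
  qed simp
  then have "(u, u') \<in> R\<^sup>*" if "u \<in> verts (Y n)" "u' \<in> verts (Y n)" for u u'
    using that rtrancl_trans[of u "hub n" R u'] by simp
  moreover have "verts (Y n) \<noteq> {}" by (simp add: Y_verts)
  ultimately show ?thesis unfolding connected_graph_def R_def[symmetric] by simp
qed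

text \<open>
  With the hub as root, the reduced Laplacian of the layer has rows and columns indexed by residues
  modulo \<open>p^n\<close>. An edge that leaves \<open>v\<close> contributes 1 to the diagonal and, if it returns to \<open>v\<close>,
  -1 to the diagonal shifted by its voltage. So the matrix is circulant.
\<close>
theorem num_spanning_trees_Y:
  "of_nat (num_spanning_trees (Y n)) =
     (\<Prod>k<p ^ n. \<Sum>e | e \<in> edges X \<and> src X e = v. 1 - of_bool (tgt X e = v) * zeta (p ^ n) k powi \<alpha> e n)"
proof -
  interpret Y: serre_graph "Y n" by (rule serre_graph_Y)
  define q where "q = p ^ n"
  have q: "q > 0" using p0 by (simp add: q_def)
  define b where "b i = vertex n v (int i)" for i
  define S where "S = {e \<in> edges X. src X e = v}"
  have finS: "finite S" using finite_edges by (simp add: S_def)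
  have vertex_eq: "vertex n v a = vertex n v c \<longleftrightarrow> a mod int q = c mod int q" for a c
    using cls_eq_iff by (simp add: vertex_def q_def)
  have not_hub: "vertex n v a \<noteq> hub n" for a using verts by (simp add: vertex_def)
  have b: "bij_betw b {..<q} (verts (Y n) - {hub n})"
    unfolding bij_betw_def
  proof
    show "inj_on b {..<q}" by (auto simp: inj_on_def b_def vertex_eq)
    show "b ` {..<q} = verts (Y n) - {hub n}"
    proof (intro equalityI subsetI)
      fix u assume "u \<in> verts (Y n) - {hub n}"
      then obtain c where c: "u = vertex n v c" by (auto simp: Y_verts)
      define i where "i = nat (c mod int q)"
      have "i < q" using q by (simp add: i_def nat_less_iff)
      moreover have "u = b i" using q by (simp add: c b_def vertex_eq i_def)
      ultimately show "u \<in> b ` {..<q}" by blast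
    qed (auto simp: b_def Y_verts not_hub not_hub[symmetric])
  qed
  \<comment> \<open>each edge contributes two terms to the circulant matrix, distinguished by the Boolean\<close>
  define c :: "'e \<times> bool \<Rightarrow> int" where "c = (\<lambda>(e, first). if first then 1 else - of_bool (tgt X e = v))"
  define a :: "'e \<times> bool \<Rightarrow> int" where "a = (\<lambda>(e, first). if first then 0 else \<alpha> e n)"
  have split: "(\<Sum>t\<in>S \<times> UNIV. g t) = (\<Sum>e\<in>S. g (e, True) + g (e, False))" for g :: "'e \<times> bool \<Rightarrow> 'a :: comm_monoid_add"
    by (simp add: sum.cartesian_product[symmetric, of "\<lambda>e f. g (e, f)", simplified] UNIV_bool add.commute)
  have entry: "(\<Sum>E | E \<in> edges (Y n) \<and> src (Y n) E = b i. of_bool (i = j) - of_bool (tgt (Y n) E = b j)) =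
      (\<Sum>t\<in>S \<times> UNIV. c t * of_bool (int j = (int i + a t) mod int q))" if ij: "i < q" "j < q" for i j
  proof -
    have "{E. E \<in> edges (Y n) \<and> src (Y n) E = b i} = (\<lambda>e. (cls n (int i), e)) ` S"
    proof (intro equalityI subsetI)
      fix E assume E: "E \<in> {E. E \<in> edges (Y n) \<and> src (Y n) E = b i}"
      then obtain d e where de: "E = (cls n d, e)" "e \<in> edges X" by (auto simp: Y_edges)
      have s: "vertex n (src X e) d = vertex n v (int i)" using E de by (simp add: Y_src b_def)
      then have "src X e = v" using not_hub by (metis vertex_def)
      moreover from this s have "cls n d = cls n (int i)" by (simp add: vertex_def)
      ultimately show "E \<in> (\<lambda>e. (cls n (int i), e)) ` S" using de by (auto simp: S_def)
    qed (auto simp: S_def Y_edges Y_src b_def)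
    moreover have "inj_on (\<lambda>e. (cls n (int i), e)) S" by (simp add: inj_on_def)
    ultimately have "(\<Sum>E | E \<in> edges (Y n) \<and> src (Y n) E = b i. of_bool (i = j) - of_bool (tgt (Y n) E = b j)) =
        (\<Sum>e\<in>S. of_bool (i = j) - of_bool (tgt (Y n) (cls n (int i), e) = b j) :: int)"
      by (simp add: sum.reindex)
    also have "\<dots> = (\<Sum>e\<in>S. c (e, True) * of_bool (int j = (int i + a (e, True)) mod int q) +
        c (e, False) * of_bool (int j = (int i + a (e, False)) mod int q))"
    proof (intro sum.cong refl)
      fix e assume e: "e \<in> S"
      have "tgt (Y n) (cls n (int i), e) = b j \<longleftrightarrow> tgt X e = v \<and> int j = (int i + \<alpha> e n) mod int q"
      proof (cases "tgt X e = v")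
        case True
        then show ?thesis using e ij by (auto simp: S_def Y_tgt b_def vertex_eq)
      next
        case False
        then have "tgt (Y n) (cls n (int i), e) = hub n" using e by (simp add: S_def Y_tgt vertex_def)
        then show ?thesis using False not_hub[of "int j"] by (simp add: b_def)
      qed
      then show "of_bool (i = j) - of_bool (tgt (Y n) (cls n (int i), e) = b j) =
          c (e, True) * of_bool (int j = (int i + a (e, True)) mod int q) +
          c (e, False) * of_bool (int j = (int i + a (e, False)) mod int q)"
        using ij by (auto simp: c_def a_def)
    qed
    also have "\<dots> = (\<Sum>t\<in>S \<times> UNIV. c t * of_bool (int j = (int i + a t) mod int q))"
      by (simp add: split)
    finally show ?thesis .
  qed
  have hub: "hub n \<in> verts (Y n)" by (simp add: Y_verts)
  have "int (num_spanning_trees (Y n)) = det (circulant q (S \<times> UNIV) c a)"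
    unfolding Y.matrix_tree[OF hub b] circulant_def
    by (intro arg_cong[of _ _ det] eq_matI) (simp_all add: entry)
  then have "complex_of_nat (num_spanning_trees (Y n)) = of_int (det (circulant q (S \<times> UNIV) c a))"
    by (metis of_int_of_nat_eq)
  also have "\<dots> = (\<Prod>k<q. \<Sum>t\<in>S \<times> UNIV. of_int (c t) * zeta q k powi a t)"
    using q finS by (intro det_circulant) simp_all
  also have "\<dots> = (\<Prod>k<q. \<Sum>e\<in>S. 1 - of_bool (tgt X e = v) * zeta q k powi \<alpha> e n)"
    unfolding split by (simp add: c_def a_def)
  finally show ?thesis by (simp add: S_def q_def)
qed

end


section \<open>A covering with prescribed invariants\<close>

text \<open>
  The undirected edge number \<open>t\<close> consists of the edges \<open>2t\<close> and \<open>2t + 1\<close>. The first \<open>K\<close> undirected edges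
  join the vertices 0 and 1, the even member leading from 0 to 1; the others are loops at 0.
\<close>
definition loop_graph :: "nat \<Rightarrow> nat \<Rightarrow> (nat, nat) sgraph" where
  "loop_graph K M =
     \<lparr> verts = {0, 1},
       edges = {..<2 * M},
       einv = (\<lambda>e. if even e then e + 1 else e - 1),
       src = (\<lambda>e. of_bool (e div 2 < K \<and> odd e)),
       tgt = (\<lambda>e. of_bool (e div 2 < K \<and> even e)) \<rparr>"

definition loop_voltage :: "nat \<Rightarrow> nat list \<Rightarrow> nat \<Rightarrow> int" where
  "loop_voltage K js e =
     (if e div 2 < K then 0 else (if even e then 1 else -1) * int (js ! (e div 2 - K)))"

lemma loop_graph_simps [simp]:
  "verts (loop_graph K M) = {0, 1}" "edges (loop_graph K M) = {..<2 * M}"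
  "einv (loop_graph K M) e = (if even e then e + 1 else e - 1)"
  "src (loop_graph K M) e = of_bool (e div 2 < K \<and> odd e)"
  "tgt (loop_graph K M) e = of_bool (e div 2 < K \<and> even e)"
  by (simp_all add: loop_graph_def)

lemma serre_graph_loop_graph: "serre_graph (loop_graph K M)"
proof
  fix e assume e: "e \<in> edges (loop_graph K M)"
  consider i where "e = 2 * i" | i where "e = Suc (2 * i)" by (metis evenE oddE Suc_eq_plus1)
  note cases = this
  show "einv (loop_graph K M) e \<in> edges (loop_graph K M)"
    "einv (loop_graph K M) (einv (loop_graph K M) e) = e"
    "einv (loop_graph K M) e \<noteq> e"
    "src (loop_graph K M) (einv (loop_graph K M) e) = tgt (loop_graph K M) e"
    "tgt (loop_graph K M) (einv (loop_graph K M) e) = src (loop_graph K M) e"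
    using e by (cases rule: cases; simp)+
  show "src (loop_graph K M) e \<in> verts (loop_graph K M)" by simp
  show "tgt (loop_graph K M) e \<in> verts (loop_graph K M)" by simp
qed simp_all

lemma loop_voltage_einv:
  "loop_voltage K js (einv (loop_graph K M) e) = - loop_voltage K js e"
proof -
  consider i where "e = 2 * i" | i where "e = Suc (2 * i)" by (metis evenE oddE Suc_eq_plus1)
  then show ?thesis by cases (simp_all add: loop_voltage_def)
qed

lemma sum_lessThan_double: "(\<Sum>e<2 * M. h e) = (\<Sum>t<M. h (2 * t) + h (Suc (2 * t)))"
  for h :: "nat \<Rightarrow> 'a :: comm_monoid_add"
  by (induction M) (simp_all add: add.assoc)

lemma loop_graph_sum:
  fixes z :: complex
  shows "(\<Sum>e | e \<in> edges (loop_graph K (K + length js)) \<and> src (loop_graph K (K + length js)) e = 0.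
      1 - of_bool (tgt (loop_graph K (K + length js)) e = 0) * z powi loop_voltage K js e) =
    of_nat K + (\<Sum>j\<leftarrow>js. 2 - z powi int j - z powi (- int j))"
proof -
  define h where "h e = (if e div 2 < K \<and> odd e then 0
    else 1 - of_bool (\<not> (e div 2 < K \<and> even e)) * z powi loop_voltage K js e)" for e
  have "(\<Sum>e | e \<in> edges (loop_graph K (K + length js)) \<and> src (loop_graph K (K + length js)) e = 0.
      1 - of_bool (tgt (loop_graph K (K + length js)) e = 0) * z powi loop_voltage K js e) =
      (\<Sum>e<2 * (K + length js). h e)"
    by (rule sum.mono_neutral_cong_left) (auto simp: h_def)
  also have "\<dots> = (\<Sum>t<K + length js. h (2 * t) + h (Suc (2 * t)))"
    by (rule sum_lessThan_double)
  also have "\<dots> = (\<Sum>t<K. h (2 * t) + h (Suc (2 * t))) +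
      (\<Sum>t<length js. h (2 * (K + t)) + h (Suc (2 * (K + t))))"
    by (induction js rule: rev_induct) (simp_all add: add.assoc)
  also have "(\<Sum>t<K. h (2 * t) + h (Suc (2 * t))) = of_nat K"
    by (simp add: h_def)
  also have "(\<Sum>t<length js. h (2 * (K + t)) + h (Suc (2 * (K + t)))) =
      (\<Sum>t<length js. 2 - z powi int (js ! t) - z powi (- int (js ! t)))"
    by (intro sum.cong refl) (simp add: h_def loop_voltage_def)
  also have "\<dots> = (\<Sum>j\<leftarrow>js. 2 - z powi int j - z powi (- int j))"
    by (simp add: sum_list_sum_nth atLeast0LessThan)
  finally show ?thesis .
qed

lemma isomorphic_to_Zp_refl:
  assumes "p > 0"
  shows "isomorphic_to_Zp p (Zp p) (Zp_topology p)"
proof -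
  have "group (Zp p)" using Zp_comm_group[OF assms] by (rule comm_group.axioms)
  moreover have "topspace (Zp_topology p) = carrier (Zp p)" by (simp add: Zp_topology_def)
  moreover have "id \<in> iso (Zp p) (Zp p)" by (simp add: iso_def hom_def)
  moreover have "homeomorphic_map (Zp_topology p) (Zp_topology p) id" by simp
  ultimately show ?thesis unfolding isomorphic_to_Zp_def by blast
qed

theorem theorem1p2:
  fixes p l m :: nat
  assumes "prime p" and "even l"
  shows "\<exists>(\<Gamma> :: (nat \<Rightarrow> int) monoid) T (X :: (nat, nat) sgraph) \<alpha> I.
           Zp_covering p \<Gamma> T X \<alpha> I \<and>
           iwasawa_invariants p \<Gamma> X \<alpha> I l m \<and>
           (\<exists>v w. v \<noteq> w \<and> verts X = {v, w} \<and> unramified \<Gamma> I v \<and> totally_ramified \<Gamma> I w)"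
proof -
  obtain r where r: "l = 2 * r" using assms(2) by blast
  have p0: "p > 0" and p1: "p > 1" using prime_gt_1_nat[OF assms(1)] by simp_all
  obtain K js N c where K: "K > 0" and
    inv: "\<And>n \<kappa> :: nat. n \<ge> N \<Longrightarrow> of_nat \<kappa> = loop_norm (p ^ n) K js \<Longrightarrow>
           int (multiplicity p \<kappa>) = int (2 * r) * int n + int m * int p ^ n + c"
    using loops_with_invariants[OF assms(1), of r m] by metis
  define X where "X = loop_graph K (K + length js)"
  define \<alpha> where "\<alpha> e = (\<lambda>n. loop_voltage K js e mod int p ^ n)" for e
  define I where "I x = (if x = 0 then {\<one>\<^bsub>Zp p\<^esub>} else carrier (Zp p))" for x :: nat
  have \<alpha>: "\<alpha> e \<in> carrier (Zp p)" for e unfolding \<alpha>_def by (rule Zp_residue[OF p0])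
  have \<alpha>_einv: "\<alpha> (einv X e) = inv\<^bsub>Zp p\<^esub> (\<alpha> e)" for e
    unfolding Zp_inv[OF p0 \<alpha>] unfolding \<alpha>_def X_def loop_voltage_einv by (simp add: mod_minus_eq)
  interpret two_vertex_voltage X p \<alpha> 0 1 I
  proof (intro two_vertex_voltage.intro two_vertex_voltage_axioms.intro)
    show "serre_graph X" unfolding X_def by (rule serre_graph_loop_graph)
    show "\<exists>e\<in>edges X. src X e = 0 \<and> tgt X e = 1"
      using K by (intro bexI[of _ 0]) (simp_all add: X_def)
    show "verts X = {0, 1}" by (simp add: X_def)
    show "I 0 = {\<one>\<^bsub>Zp p\<^esub>}" "I 1 = carrier (Zp p)" by (simp_all add: I_def)
    show "p > 1" by (rule p1)
  qed (simp_all add: \<alpha> \<alpha>_einv)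
  have group: "group (Zp p)" using Zp_comm_group[OF p0] by (rule comm_group.axioms)
  have top: "topspace (Zp_topology p) = carrier (Zp p)" by (simp add: Zp_topology_def)
  have haus: "Hausdorff_space (Zp_topology p)"
    unfolding Zp_topology_def by (intro Hausdorff_space_subtopology) (simp add: Hausdorff_space_product_topology)
  have one: "\<one>\<^bsub>Zp p\<^esub> \<in> carrier (Zp p)" using group by (rule group.is_monoid[THEN monoid.one_closed])
  have cov: "Zp_covering p (Zp p) (Zp_topology p) X \<alpha> I"
  proof (intro Zp_covering.intro Zp_covering_axioms.intro serre_graph_axioms isomorphic_to_Zp_refl p0 connected_Y \<alpha> \<alpha>_einv)
    fix x
    show "subgroup (I x) (Zp p)"
      using group.triv_subgroup[OF group] group.subgroup_self[OF group] by (simp add: I_def)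
    show "closedin (Zp_topology p) (I x)"
      using closedin_Hausdorff_singleton[OF haus, of "\<one>\<^bsub>Zp p\<^esub>"] one closedin_topspace[of "Zp_topology p"]
      by (simp add: I_def top)
  qed
  have trees: "of_nat (num_spanning_trees (Y n)) = loop_norm (p ^ n) K js" for n
  proof -
    have "zeta (p ^ n) k powi \<alpha> e n = zeta (p ^ n) k powi loop_voltage K js e" for k e
      using zeta_powi_mod[of "p ^ n" k "loop_voltage K js e"] p0 by (simp add: \<alpha>_def)
    then show ?thesis
      unfolding num_spanning_trees_Y loop_norm_def by (simp only: X_def loop_graph_sum)
  qed
  have "iwasawa_invariants p (Zp p) X \<alpha> I l m"
    unfolding iwasawa_invariants_def eventually_sequentially r
    using inv trees by blast
  moreover have "(0 :: nat) \<noteq> 1 \<and> verts X = {0, 1} \<and> unramified (Zp p) I 0 \<and> totally_ramified (Zp p) I 1"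
    by (simp add: X_def unramified_def totally_ramified_def I_def)
  ultimately show ?thesis using cov by blast
qed

end
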